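(* Let $T_0>0$, $r\ge0$ and, for real $\phi\ne0$, let $$\Psi(\phi)=\frac{1}{2\pi^2}\sum_{n=1}^\infty\frac{T_0^2}{n^2+4\sin^2\!\left(\frac{n\phi}{2}\right)T_0^2r^2}.$$ Then, to all orders in $\phi$ as $\phi\to0^\pm$, $$\Psi(\phi)\sim\frac1{12}\frac{T_0^2}{1+r^2T_0^2\phi^2}-\frac{r^2T_0^4\phi^4}{48\pi^2(1+r^2T_0^2\phi^2)^2}\pm I_f(r^2T_0^2\phi^2)\,\frac{\phi\,T_0^2}{2\pi^2},$$ where $$I_f(x^2)=\int_0^\infty\left[\frac{1}{y^2+4x^2\sin^2(y/2)}-\frac{1}{(1+x^2)y^2}\right]dy .$$ Consequently the analytic distillate of $\Psi$ at $\phi=0$ is the sum of the first two terms, and its value at $\phi=i\omega/T_0$, for real $\omega$ with $r|\omega|<1$, is $$\langle:\hat\psi^2:\rangle=\frac1{12}\frac{T_0^2}{1-r^2\omega^2}-\frac{r^2\omega^4}{48\pi^2(1-r^2\omega^2)^2}=\frac{1}{12\beta^2}+\frac{\alpha^2}{48\pi^2\beta^2},$$ where $\beta^2=\frac{1-r^2\omega^2}{T_0^2}$ and $\alpha^2=-(\gamma^2-1)\frac{\omega^2}{T_0^2}$ with $\gamma=(1-r^2\omega^2)^{-1/2}$.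
   Context: "To all orders" means that for every $N$ the difference of the two sides is $O(|\phi|^N)$ as $\phi\to0^+$ (upper sign) and as $\phi\to0^-$ (lower sign). $\Psi$ is the thermal expectation value of the normal ordered squared massless neutral scalar field in rotational equilibrium (density operator proportional to $\exp[-\hat H/T_0+\omega\hat J_z/T_0]$) at imaginary angular velocity, at distance $r$ from the axis. Analytic distillate at $0$ of a function on $\mathbb R\setminus\{0\}$: suppose that $f(\phi)\sim\sum_n a_n^{\pm}\phi^n$ as $\phi\to0^\pm$ (asymptotic power series, $n$ integer, possibly finitely many negative values). Put $\bar a_n=a^+_n$ if $a_n^+=a_n^-$ and $\bar a_n=0$ otherwise. If $\sum_{n\ge0}\bar a_n\phi^n$ has positive radius of convergence, the analytic function it defines (with its analytic continuation) is the analytic distillate of $f$ at $0$. *)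

theory Defs
  imports "HOL-Complex_Analysis.Complex_Analysis" "HOL-Library.Landau_Symbols"
begin

definition Psi :: "real \<Rightarrow> real \<Rightarrow> real \<Rightarrow> real" where
  "Psi T0 r \<phi> = 1 / (2 * pi\<^sup>2) *
     (\<Sum>k. T0\<^sup>2 / ((real (Suc k))\<^sup>2 + 4 * (sin (real (Suc k) * \<phi> / 2))\<^sup>2 * T0\<^sup>2 * r\<^sup>2))"

text \<open>The argument \<open>s\<close> of \<open>I_f\<close> is the quantity written \<open>x\<^sup>2\<close> in the integrand.\<close>

definition I_f :: "real \<Rightarrow> real" where
  "I_f s = (LBINT y:{0<..}. 1 / (y\<^sup>2 + 4 * s * (sin (y / 2))\<^sup>2) - 1 / ((1 + s) * y\<^sup>2))"

definition gamma_factor :: "real \<Rightarrow> real \<Rightarrow> real" where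
  "gamma_factor r \<omega> = (1 - r\<^sup>2 * \<omega>\<^sup>2) powr (-1/2)"

definition beta_sq :: "real \<Rightarrow> real \<Rightarrow> real \<Rightarrow> real" where
  "beta_sq T0 r \<omega> = (1 - r\<^sup>2 * \<omega>\<^sup>2) / T0\<^sup>2"

definition alpha_sq :: "real \<Rightarrow> real \<Rightarrow> real \<Rightarrow> real" where
  "alpha_sq T0 r \<omega> = - ((gamma_factor r \<omega>)\<^sup>2 - 1) * (\<omega>\<^sup>2 / T0\<^sup>2)"

text \<open>Poincare-type asymptotic expansion in integer powers, finitely many of them negative.
  The formal Laurent series only stores the coefficients; no convergence is involved. When
  \<open>N < fls_subdegree A\<close> the sum is empty.\<close>

definition asymptotic_series :: "(real \<Rightarrow> complex) \<Rightarrow> complex fls \<Rightarrow> real filter \<Rightarrow> bool" where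
  "asymptotic_series f A F \<longleftrightarrow> (\<forall>N::int.
     (\<lambda>\<phi>. f \<phi> - (\<Sum>n = fls_subdegree A..N. fls_nth A n * complex_of_real \<phi> powi n))
       \<in> o[F](\<lambda>\<phi>. complex_of_real \<phi> powi N))"

definition common_part :: "complex fls \<Rightarrow> complex fls \<Rightarrow> complex fps" where
  "common_part A B =
     Abs_fps (\<lambda>n. if fls_nth A (int n) = fls_nth B (int n) then fls_nth A (int n) else 0)"

text \<open>\<open>g\<close> on the domain \<open>D\<close> is the analytic distillate at \<open>0\<close>, continued analytically to \<open>D\<close>.
  Note that \<open>has_fps_expansion\<close> includes positivity of the radius of convergence.\<close>

definition analytic_distillate ::
    "(real \<Rightarrow> complex) \<Rightarrow> complex set \<Rightarrow> (complex \<Rightarrow> complex) \<Rightarrow> bool" where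
  "analytic_distillate f D g \<longleftrightarrow>
     open D \<and> connected D \<and> 0 \<in> D \<and> g holomorphic_on D \<and>
     (\<exists>A B. asymptotic_series f A (at_right 0) \<and> asymptotic_series f B (at_left 0) \<and>
            g has_fps_expansion common_part A B)"

lemma asymptotic_series_extend:
  assumes "asymptotic_series f A F" "m \<le> fls_subdegree A"
  shows "(\<lambda>\<phi>. f \<phi> - (\<Sum>n = m..N. fls_nth A n * complex_of_real \<phi> powi n))
           \<in> o[F](\<lambda>\<phi>. complex_of_real \<phi> powi N)"
proof -
  have "(\<Sum>n = m..N. fls_nth A n * complex_of_real \<phi> powi n) =
        (\<Sum>n = fls_subdegree A..N. fls_nth A n * complex_of_real \<phi> powi n)" for \<phi>
    by (rule sum.mono_neutral_right) (use assms(2) in auto)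
  with assms(1) show ?thesis
    by (simp add: asymptotic_series_def)
qed

lemma asymptotic_series_unique:
  assumes "asymptotic_series f A F" "asymptotic_series f B F"
    and "F \<noteq> bot" "eventually (\<lambda>\<phi>. \<phi> \<noteq> 0) F"
  shows "A = B"
proof (rule ccontr)
  assume "A \<noteq> B"
  define N where "N = fls_subdegree (A - B)"
  define c where "c = fls_nth (A - B) N"
  define m where "m = Min {fls_subdegree A, fls_subdegree B, N}"
  have m: "m \<le> fls_subdegree A" "m \<le> fls_subdegree B" "m \<le> N"
    by (auto simp: m_def)
  have c: "c \<noteq> 0"
    using \<open>A \<noteq> B\<close> unfolding c_def N_def by (metis nth_fls_subdegree_nonzero right_minus_eq)
  have "(\<Sum>n = m..N. fls_nth A n * complex_of_real \<phi> powi n) -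
        (\<Sum>n = m..N. fls_nth B n * complex_of_real \<phi> powi n) = c * complex_of_real \<phi> powi N" for \<phi>
  proof -
    have "(\<Sum>n = m..N. fls_nth A n * complex_of_real \<phi> powi n) -
          (\<Sum>n = m..N. fls_nth B n * complex_of_real \<phi> powi n) =
          (\<Sum>n = m..N. fls_nth (A - B) n * complex_of_real \<phi> powi n)"
      by (simp add: sum_subtractf algebra_simps)
    also have "\<dots> = (\<Sum>n \<in> {N}. fls_nth (A - B) n * complex_of_real \<phi> powi n)"
    proof (rule sum.mono_neutral_right)
      show "\<forall>i\<in>{m..N} - {N}. fls_nth (A - B) i * complex_of_real \<phi> powi i = 0"
      proof
        fix i assume "i \<in> {m..N} - {N}"
        hence "i < fls_subdegree (A - B)" by (auto simp: N_def)
        hence "fls_nth (A - B) i = 0" by (rule fls_eq0_below_subdegree)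
        thus "fls_nth (A - B) i * complex_of_real \<phi> powi i = 0" by simp
      qed
    qed (use m in auto)
    finally show ?thesis by (simp add: c_def)
  qed
  moreover have "(\<lambda>\<phi>. (f \<phi> - (\<Sum>n = m..N. fls_nth B n * complex_of_real \<phi> powi n)) -
                 (f \<phi> - (\<Sum>n = m..N. fls_nth A n * complex_of_real \<phi> powi n)))
               \<in> o[F](\<lambda>\<phi>. complex_of_real \<phi> powi N)"
    by (intro sum_in_smallo asymptotic_series_extend assms m)
  ultimately have "(\<lambda>\<phi>. c * complex_of_real \<phi> powi N) \<in> o[F](\<lambda>\<phi>. complex_of_real \<phi> powi N)"
    by (simp add: algebra_simps)
  hence "(\<lambda>\<phi>. complex_of_real \<phi> powi N) \<in> o[F](\<lambda>\<phi>. complex_of_real \<phi> powi N)"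
    using c by simp
  hence "eventually (\<lambda>\<phi>. complex_of_real \<phi> powi N = 0) F"
    by (simp add: landau_o.small_refl_iff)
  with assms(4) have "eventually (\<lambda>_. False) F"
    by eventually_elim (auto simp: power_int_eq_0_iff)
  with assms(3) show False
    by (simp add: eventually_False)
qed

lemma analytic_distillate_unique:
  assumes "analytic_distillate f D g" "analytic_distillate f D h" "z \<in> D"
  shows "g z = h z"
proof -
  obtain A B where AB: "asymptotic_series f A (at_right 0)" "asymptotic_series f B (at_left 0)"
      "g has_fps_expansion common_part A B"
    using assms(1) by (auto simp: analytic_distillate_def)
  obtain A' B' where AB': "asymptotic_series f A' (at_right 0)" "asymptotic_series f B' (at_left 0)"
      "h has_fps_expansion common_part A' B'"
    using assms(2) by (auto simp: analytic_distillate_def)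
  have "A = A'"
    by (rule asymptotic_series_unique[OF AB(1) AB'(1)])
       (auto simp: eventually_at_filter)
  moreover have "B = B'"
    by (rule asymptotic_series_unique[OF AB(2) AB'(2)])
       (auto simp: eventually_at_filter)
  ultimately have "eventually (\<lambda>w. g w = h w) (nhds 0)"
    using AB(3) AB'(3) unfolding has_fps_expansion_def
    by (auto elim: eventually_elim2)
  then obtain U where U: "open U" "0 \<in> U" "\<And>w. w \<in> U \<Longrightarrow> g w = h w"
    by (auto simp: eventually_nhds)
  have D: "open D" "connected D" "0 \<in> D" "g holomorphic_on D" "h holomorphic_on D"
    using assms by (auto simp: analytic_distillate_def)
  have "g z - h z = 0"
  proof (rule analytic_continuation[where f = "\<lambda>w. g w - h w" and S = D and U = "U \<inter> D" and \<xi> = 0])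
    show "0 islimpt U \<inter> D"
      using U D by (intro open_imp_islimpt) auto
  qed (use U D assms(3) in \<open>auto intro!: holomorphic_intros\<close>)
  thus ?thesis by simp
qed

end

(* Write u(y) = (sin (y/2) / (y/2))^2 and s = r^2 T0^2 phi^2. Then Psi is T0^2 / (2 pi^2) times the
   sum over n >= 1 of 1 / (n^2 (1 + s u(n phi))), and the geometric series of 1 / (1 + s u), truncated
   at order K, costs only O(s^K) = O(phi^(2K)). The power u^k is the characteristic function of a sum X
   of 2k independent uniform variables on [-1/2, 1/2], so |X| <= k and E X^2 = k/6. Averaging
     sum (1 - cos (n t)) / n^2 = pi t / 2 - t^2 / 4   (0 <= t <= 2 pi),
     int_0^oo (1 - cos (t y)) / y^2 dy = pi |t| / 2
   over t = |X| |phi|, respectively t = X, evaluates the k-th sum exactly once k |phi| <= 2 pi: its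
   contribution linear in |phi| is the k-th term of I_f, and its contribution quadratic in phi sums to
   the second term of the expansion. In the distillate, I_f contributes only odd powers of phi, with
   opposite signs on the two sides. *)

theory Submission
  imports Defs "HOL-Probability.Probability" "HOL-Real_Asymp.Real_Asymp"
begin

text \<open>What makes an error below every power of \<phi> reachable is that the k-th lattice sum
  is evaluated without any error, as a polynomial of degree 2 in \<open>\<bar>\<phi>\<bar>\<close>;
  only geometric tails are estimated. The bound 2 pi comes from the periodicity of the cosine
  series: outside [0, 2 pi] the quadratic polynomial no longer represents it. For a fixed truncation
  order K this excludes no small \<phi>, but the admissible range shrinks as K grows, so the result
  is asymptotic and not a convergent expansion. The mean of |X| is never computed. It suffices that
  the same number appears in the sum and in the integral, so that it cancels between
  \<open>Psi\<close> and \<open>I_f\<close>. The term subtracted inside \<open>I_f\<close> reflects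
  the splitting u^k = 1 - (1 - u^k): the constants 1 sum to pi^2/6 times 1 / (1 + s), the first term
  of the expansion, and only 1 - u^k, which is O(y^2) at 0, is integrated against 1 / y^2. The
  double pole of the second term comes from the sum of k (-s)^k, which is -s / (1 + s)^2, since the
  variance grows linearly in k.\<close>

section \<open>A Fourier series and a cosine integral\<close>

lemma summable_inverse_square_Suc: "summable (\<lambda>n. 1 / (real (Suc n))\<^sup>2)"
  using inverse_squares_sums by (simp add: sums_iff add.commute)

text \<open>Taking out \<open>cis (t / 2)\<close> leaves \<open>- 2 * \<i> * sin (t / 2)\<close>,
  and \<open>- \<i>\<close> is the quarter turn \<open>- pi / 2\<close>. For
  \<open>0 < t < 2 * pi\<close> the real factor is positive and the angle lies in the principal
  range, so the argument can be read off.\<close>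

lemma one_minus_cis_polar: "1 - cis t = of_real (2 * sin (t / 2)) * cis ((t - pi) / 2)"
proof -
  have "cis t = cis (t/2) * cis (t/2)" by (simp add: cis_mult)
  have "(t - pi) / 2 = t/2 - pi/2" by (simp add: field_simps)
  hence "cos ((t - pi) / 2) = sin (t/2)" "sin ((t - pi) / 2) = - cos (t/2)"
    by (simp_all only: cos_diff sin_diff) simp_all
  moreover have "cos t = 1 - 2 * (sin (t/2))\<^sup>2" "sin t = 2 * sin (t/2) * cos (t/2)"
    using cos_double_sin[of "t/2"] sin_double[of "t/2"] by simp_all
  ultimately show ?thesis
    by (simp add: complex_eq_iff power2_eq_square)
qed

lemma Im_Ln_one_minus_cis:
  assumes "0 < t" "t < 2 * pi"
  shows "Im (Ln (1 - cis t)) = (t - pi) / 2" "1 - cis t \<notin> \<real>\<^sub>\<le>\<^sub>0"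
proof -
  have s: "sin (t/2) > 0" using assms by (intro sin_gt_zero) auto
  have c: "Re (1 - cis t) > 0"
  proof -
    have "cos t = 1 - 2 * (sin (t/2))\<^sup>2" using cos_double_sin[of "t/2"] by simp
    thus ?thesis using s by simp
  qed
  then show "1 - cis t \<notin> \<real>\<^sub>\<le>\<^sub>0"
    by (auto simp: complex_nonpos_Reals_iff)
  have nz: "1 - cis t \<noteq> 0" using c by force
  have "Arg (1 - cis t) = (t - pi) / 2"
    unfolding one_minus_cis_polar using s assms
    by (intro Arg_unique'[of "2 * sin (t / 2)"]) (auto simp: rcis_def)
  thus "Im (Ln (1 - cis t)) = (t - pi) / 2"
    using nz by (simp add: Arg_eq_Im_Ln)
qed

lemma sums_power_sin_over_n:
  assumes "0 \<le> \<rho>" "\<rho> < 1"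
  shows "(\<lambda>n. \<rho> ^ Suc n * sin (real (Suc n) * t) / real (Suc n)) sums (- Im (Ln (1 - of_real \<rho> * cis t)))"
proof -
  let ?z = "of_real \<rho> * cis t"
  have "cmod (- ?z) < 1" using assms by (simp add: norm_mult)
  from Ln_series'[OF this]
  have "(\<lambda>n. - (?z ^ n) / of_nat n) sums Ln (1 - ?z)" by simp
  \<comment> \<open>The term at \<open>n = 0\<close> is a division by 0, hence 0, so the index shift
    loses nothing.\<close>
  hence "(\<lambda>n. - (?z ^ Suc n) / of_nat (Suc n)) sums Ln (1 - ?z)"
    by (subst sums_Suc_iff) simp
  from sums_minus[OF sums_Im[OF this]]
  show ?thesis
    by (simp add: power_mult_distrib Complex.DeMoivre Im_divide_of_nat of_real_power [symmetric] 
       del: of_nat_Suc power_Suc of_real_power)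
qed

text \<open>The factor \<open>\<rho> ^ Suc n\<close> is the majorant that licenses termwise
  differentiation. The undamped series of \<open>sin (n * t) / n\<close> does not converge uniformly
  near \<open>t = 0\<close>.\<close>

lemma has_integral_damped_one_minus_cos:
  assumes "0 \<le> \<rho>" "\<rho> < 1" "0 \<le> \<theta>"
  shows "((\<lambda>t. - Im (Ln (1 - of_real \<rho> * cis t))) has_integral
           (\<Sum>n. \<rho> ^ Suc n * ((1 - cos (real (Suc n) * \<theta>)) / (real (Suc n))\<^sup>2))) {0..\<theta>}"
proof -
  define f where "f n t = \<rho> ^ Suc n * ((1 - cos (real (Suc n) * t)) / (real (Suc n))\<^sup>2)" for n t
  define f' where "f' n t = \<rho> ^ Suc n * sin (real (Suc n) * t) / real (Suc n)" for n t
  have d: "((\<lambda>t. \<Sum>n. f n t) has_field_derivative (\<Sum>n. f' n t)) (at t)" for t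
  proof (rule has_field_derivative_series'(2))
    show "(f n has_field_derivative f' n t) (at t within UNIV)" for n t
      unfolding f_def f'_def
      by (auto intro!: derivative_eq_intros simp del: of_nat_Suc power_Suc simp: power2_eq_square)
    show "uniformly_convergent_on UNIV (\<lambda>n t. \<Sum>i<n. f' i t)"
    proof (rule Weierstrass_m_test')
      show "summable (\<lambda>n. \<rho> ^ Suc n)" using assms by (simp add: summable_geometric)
      show "norm (f' n t) \<le> \<rho> ^ Suc n" for n t
      proof -
        have "\<bar>sin (real (Suc n) * t)\<bar> / real (Suc n) \<le> 1"
          using abs_sin_le_one[of "real (Suc n) * t"] by (simp add: field_simps del: abs_sin_le_one)
        hence "\<rho> ^ Suc n * (\<bar>sin (real (Suc n) * t)\<bar> / real (Suc n)) \<le> \<rho> ^ Suc n * 1"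
          using assms by (intro mult_left_mono) auto
        thus ?thesis using assms by (simp add: f'_def abs_mult del: power_Suc of_nat_Suc)
      qed
    qed
    show "summable (\<lambda>n. f n 0)" by (simp add: f_def)
  qed auto
  have "(\<Sum>n. f' n t) = - Im (Ln (1 - of_real \<rho> * cis t))" for t
    using sums_power_sin_over_n[OF assms(1,2), of t] unfolding f'_def by (simp add: sums_iff)
  with d have d: "((\<lambda>t. \<Sum>n. f n t) has_field_derivative - Im (Ln (1 - of_real \<rho> * cis t))) (at t)" for t
    by simp
  have "((\<lambda>t. - Im (Ln (1 - of_real \<rho> * cis t))) has_integral (\<Sum>n. f n \<theta>) - (\<Sum>n. f n 0)) {0..\<theta>}"
    using assms(3) d
    by (intro fundamental_theorem_of_calculus)
       (auto simp: has_real_derivative_iff_has_vector_derivative [symmetric] intro: has_field_derivative_at_within)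
  thus ?thesis by (simp add: f_def)
qed

text \<open>Abel summation: the derivative of the damped series is \<open>- Im (Ln (1 - \<rho> * cis t))\<close>, which is
  bounded by \<open>pi\<close> and tends to \<open>(pi - t) / 2\<close> as \<open>\<rho>\<close> tends to \<open>1\<close>.\<close>

lemma sums_one_minus_cos_over_square:
  assumes "0 \<le> \<theta>" "\<theta> \<le> 2 * pi"
  shows "(\<lambda>n. (1 - cos (real (Suc n) * \<theta>)) / (real (Suc n))\<^sup>2) sums (pi * \<theta> / 2 - \<theta>\<^sup>2 / 4)"
proof -
  define a where "a n = (1 - cos (real (Suc n) * \<theta>)) / (real (Suc n))\<^sup>2" for n
  \<comment> \<open>A sequence tending to 1 from below: dominated convergence is applied to
    sequences of functions.\<close>
  define \<rho> where "\<rho> k = 1 - 1 / real (k + 2)" for k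
  have \<rho>: "0 \<le> \<rho> k" "\<rho> k < 1" for k by (auto simp: \<rho>_def)
  have \<rho>1: "\<rho> \<longlonglongrightarrow> 1" unfolding \<rho>_def by real_asymp
  have na: "norm (a n) \<le> 2 * (1 / (real (Suc n))\<^sup>2)" for n
  proof -
    have "\<bar>1 - cos (real (Suc n) * \<theta>)\<bar> \<le> 2"
      using cos_ge_minus_one[of "real (Suc n) * \<theta>"] cos_le_one[of "real (Suc n) * \<theta>"] by linarith
    thus ?thesis by (simp add: a_def divide_right_mono del: of_nat_Suc)
  qed
  have sM: "summable (\<lambda>n. 2 * (1 / (real (Suc n))\<^sup>2))"
    by (intro summable_mult summable_inverse_square_Suc)
  have lim: "(\<lambda>k. \<Sum>n. \<rho> k ^ Suc n * a n) \<longlonglongrightarrow> (\<Sum>n. a n)"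
  proof (rule tannerys_theorem[THEN conjunct2, THEN conjunct2])
    show "(\<lambda>k. \<rho> k ^ Suc n * a n) \<longlonglongrightarrow> a n" for n
      using tendsto_mult[OF tendsto_power[OF \<rho>1, of "Suc n"] tendsto_const[of "a n"]] by simp
    show "\<forall>\<^sub>F (n, k) in at_top \<times>\<^sub>F sequentially. norm (\<rho> k ^ Suc n * a n) \<le> 2 * (1 / (real (Suc n))\<^sup>2)"
    proof (intro always_eventually allI, clarify)
      fix n k
      have "norm (\<rho> k ^ Suc n * a n) \<le> 1 * norm (a n)"
        unfolding norm_mult using \<rho>[of k]
        by (intro mult_right_mono) (auto simp: norm_power power_le_one simp del: power_Suc)
      thus "norm (\<rho> k ^ Suc n * a n) \<le> 2 * (1 / (real (Suc n))\<^sup>2)" using na[of n] by simp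
    qed
  qed (use sM in auto)
  \<comment> \<open>At \<open>t = 0\<close> and \<open>t = 2 * pi\<close> the damped functions
    vanish and do not tend to \<open>(pi - t) / 2\<close>. Both sides are set to 0 there, which
    changes them only on a null set.\<close>
  let ?g = "\<lambda>t. if t = 0 \<or> t = 2 * pi then 0 else (pi - t) / 2"
  let ?f = "\<lambda>k t. if t = 0 \<or> t = 2 * pi then 0 else - Im (Ln (1 - of_real (\<rho> k) * cis t))"
  have "(?g has_integral (\<Sum>n. a n)) {0..\<theta>}"
  proof (rule has_integral_dominated_convergence[where f = ?f, OF _ _ _ _ lim])
    show "(?f k has_integral (\<Sum>n. \<rho> k ^ Suc n * a n)) {0..\<theta>}" for k
      unfolding a_def
      by (rule has_integral_spike[OF _ _ has_integral_damped_one_minus_cos[OF \<rho> assms(1)], of "{0, 2 * pi}"]) auto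
    show "(\<lambda>t. pi) integrable_on {0..\<theta>}" by (rule integrable_const_ivl)
    show "\<forall>x\<in>{0..\<theta>}. norm (?f k x) \<le> pi" for k
    proof (clarify)
      fix t
      have "cmod (of_real (\<rho> k) * cis t) < 1" using \<rho>[of k] by (simp add: norm_mult)
      hence "1 - of_real (\<rho> k) * cis t \<noteq> 0" by force
      from mpi_less_Im_Ln[OF this] Im_Ln_le_pi[OF this] 
      show "norm (?f k t) \<le> pi" by auto
    qed
    show "\<forall>t\<in>{0..\<theta>}. (\<lambda>k. ?f k t) \<longlonglongrightarrow> ?g t"
    proof
      fix t assume t: "t \<in> {0..\<theta>}"
      show "(\<lambda>k. ?f k t) \<longlonglongrightarrow> ?g t"
      proof (cases "t = 0 \<or> t = 2 * pi")
        case False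
        with t assms have t': "0 < t" "t < 2 * pi" by auto
        have "(\<lambda>k. - Im (Ln (1 - of_real (\<rho> k) * cis t))) \<longlonglongrightarrow> - Im (Ln (1 - of_real 1 * cis t))"
          using Im_Ln_one_minus_cis(2)[OF t'] by (intro tendsto_intros \<rho>1) simp
        moreover have "- Im (Ln (1 - of_real 1 * cis t)) = (pi - t) / 2"
          using Im_Ln_one_minus_cis(1)[OF t'] by (simp add: field_simps)
        ultimately have "(\<lambda>k. - Im (Ln (1 - of_real (\<rho> k) * cis t))) \<longlonglongrightarrow> (pi - t) / 2"
          by (simp only:)
        with False show ?thesis by simp
      qed auto
    qed
  qed
  hence 1: "((\<lambda>t. (pi - t) / 2) has_integral (\<Sum>n. a n)) {0..\<theta>}"
    by (rule has_integral_spike[rotated 2, of _ _ _ "{0, 2 * pi}"]) auto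
  have "((\<lambda>t. (pi - t) / 2) has_integral (pi * \<theta> / 2 - \<theta>\<^sup>2 / 4) - (pi * 0 / 2 - 0\<^sup>2 / 4)) {0..\<theta>}"
    using assms(1)
    by (intro fundamental_theorem_of_calculus)
       (auto simp: has_real_derivative_iff_has_vector_derivative [symmetric] field_simps
             intro!: derivative_eq_intros)
  with 1 have "(\<Sum>n. a n) = pi * \<theta> / 2 - \<theta>\<^sup>2 / 4"
    by (auto dest: has_integral_unique)
  moreover have "summable a"
    by (rule summable_comparison_test'[OF sM na])
  ultimately show ?thesis unfolding a_def by (simp add: sums_iff)
qed

text \<open>Integration by parts lowers the power of the denominator and leaves
  \<open>\<bar>t\<bar>\<close> times the Dirichlet integral, whose value is \<open>pi / 2\<close>;
  the antiderivative \<open>F\<close> below records this. As the integrand is nonnegative, the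
  limits of \<open>F\<close> at both ends yield integrability together with the value.\<close>

lemma integral_one_minus_cos_over_square:
  fixes t :: real
  shows "set_integrable lborel {0<..} (\<lambda>y. (1 - cos (t * y)) / y\<^sup>2)"
    and "(LBINT y:{0<..}. (1 - cos (t * y)) / y\<^sup>2) = pi * \<bar>t\<bar> / 2"
proof -
  define c where "c = \<bar>t\<bar>"
  have c: "cos (t * y) = cos (c * y)" for y by (cases "t \<ge> 0") (auto simp: c_def)
  show "set_integrable lborel {0<..} (\<lambda>y. (1 - cos (t * y)) / y\<^sup>2)"
    and "(LBINT y:{0<..}. (1 - cos (t * y)) / y\<^sup>2) = pi * \<bar>t\<bar> / 2"
  proof (atomize(full), cases "t = 0")
    case False
    hence c0: "c > 0" by (simp add: c_def)
    define F where "F y = c * Si (c * y) - (1 - cos (c * y)) / y" for y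
    have D: "(F has_real_derivative (1 - cos (c * y)) / y\<^sup>2) (at y)" if "y > 0" for y
      unfolding F_def using that c0
      by (auto intro!: derivative_eq_intros DERIV_Si[THEN DERIV_chain2] simp: field_simps power2_eq_square)
    have cont: "isCont (\<lambda>y. (1 - cos (c * y)) / y\<^sup>2) y" if "y > 0" for y
      using that by (intro continuous_intros) auto
    have lim0: "((F \<circ> real_of_ereal) \<longlongrightarrow> 0) (at_right 0)"
    proof -
      have "(F \<longlongrightarrow> c * Si (c * 0) - 0) (at_right 0)"
        unfolding F_def
      proof (intro tendsto_intros)
        show "((\<lambda>y. Si (c * y)) \<longlongrightarrow> Si (c * 0)) (at_right 0)"
          by (rule isCont_tendsto_compose[OF isCont_Si]) (intro tendsto_intros)
        show "((\<lambda>y. (1 - cos (c * y)) / y) \<longlongrightarrow> 0) (at_right 0)"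
          by real_asymp
      qed
      thus ?thesis by (simp add: zero_ereal_def ereal_tendsto_simps Si_def)
    qed
    have limi: "((F \<circ> real_of_ereal) \<longlongrightarrow> c * (pi / 2)) (at_left \<infinity>)"
    proof -
      have "(F \<longlongrightarrow> c * (pi / 2) - 0) at_top"
        unfolding F_def
      proof (intro tendsto_intros)
        have "filterlim (\<lambda>y. c * y) at_top at_top" using c0 by real_asymp
        thus "((\<lambda>y. Si (c * y)) \<longlongrightarrow> pi / 2) at_top"
          by (rule filterlim_compose[OF Si_at_top])
        show "((\<lambda>y. (1 - cos (c * y)) / y) \<longlongrightarrow> 0) at_top"
        proof (rule real_tendsto_sandwich[of "\<lambda>_. 0" _ _ "\<lambda>y. 2 / y"])
          show "\<forall>\<^sub>F y in at_top. 0 \<le> (1 - cos (c * y)) / y"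
            using eventually_gt_at_top[of 0] by eventually_elim simp
          have "1 - cos x \<le> 2" for x :: real using cos_ge_minus_one[of x] by linarith
          thus "\<forall>\<^sub>F y in at_top. (1 - cos (c * y)) / y \<le> 2 / y"
            by (intro eventually_mono[OF eventually_gt_at_top[of 0]] divide_right_mono) auto
        qed real_asymp+
      qed
      thus ?thesis by (simp add: ereal_tendsto_simps)
    qed
    note FTC = interval_integral_FTC_nonneg[of 0 \<infinity> F "\<lambda>y. (1 - cos (c * y)) / y\<^sup>2", OF _ _ _ _ lim0 limi]
    have "set_integrable lborel (einterval 0 \<infinity>) (\<lambda>y. (1 - cos (c * y)) / y\<^sup>2)"
      by (rule FTC(1)) (auto intro!: D cont simp: zero_ereal_def)
    moreover have "(LBINT y=0..\<infinity>. (1 - cos (c * y)) / y\<^sup>2) = c * (pi / 2) - 0"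
      by (rule FTC(2)) (auto intro!: D cont simp: zero_ereal_def)
    moreover have "einterval 0 \<infinity> = {0<..}" by (simp add: zero_ereal_def einterval_eq)
    ultimately show "set_integrable lborel {0<..} (\<lambda>y. (1 - cos (t * y)) / y\<^sup>2) \<and>
      (LBINT y:{0<..}. (1 - cos (t * y)) / y\<^sup>2) = pi * \<bar>t\<bar> / 2"
      by (simp add: c interval_lebesgue_integral_0_infty) (simp add: c_def)
  qed (auto simp: set_integrable_def set_lebesgue_integral_def)
qed

section \<open>Powers of the squared sinc function as characteristic functions\<close>

text \<open>Each induction step adds an independent uniform variable, as the image of a product
  measure under addition. By symmetry of the uniform law the cross terms vanish, both in the
  addition formula for the cosine and in the square, so cosine moment and second moment suffice as
  induction data. The case \<open>y = 0\<close> is excluded because \<open>0 / 0 = 0\<close> would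
  falsify the formula for positive \<open>m\<close>.\<close>

lemma exists_sum_of_uniforms:
  "\<exists>M::real measure. prob_space M \<and> sets M = sets borel \<and> (AE x in M. \<bar>x\<bar> \<le> real m / 2) \<and>
     (\<forall>y. y \<noteq> 0 \<longrightarrow> (\<integral>x. cos (x * y) \<partial>M) = (sin (y / 2) / (y / 2)) ^ m) \<and>
     (\<integral>x. x\<^sup>2 \<partial>M) = real m / 12"
proof (induction m)
  case 0
  have "prob_space (return borel (0::real))" by (rule prob_space_return) simp
  moreover have "AE x in return borel (0::real). \<bar>x\<bar> \<le> 0" by (subst AE_return) auto
  ultimately show ?case
    by (intro exI[of _ "return borel 0"]) (auto simp: integral_return)
next
  case (Suc m)
  then obtain M :: "real measure" where M: "prob_space M" and [measurable_cong]: "sets M = sets borel"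
    and bd: "AE x in M. \<bar>x\<bar> \<le> real m / 2"
    and cosM: "\<And>y. y \<noteq> 0 \<Longrightarrow> (\<integral>x. cos (x * y) \<partial>M) = (sin (y / 2) / (y / 2)) ^ m"
    and sqM: "(\<integral>x. x\<^sup>2 \<partial>M) = real m / 12"
    by blast
  define U :: "real measure" where "U = density lborel (\<lambda>x. ennreal (indicator {-1/2..1/2} x))"
  have [measurable_cong]: "sets U = sets borel" by (simp add: U_def)
  interpret M: prob_space M by fact
  interpret U: prob_space U
    by (rule prob_spaceI) (simp add: U_def emeasure_density nn_integral_indicator ennreal_indicator)
  interpret P: pair_prob_space M U ..
  have bdU: "AE v in U. \<bar>v\<bar> \<le> 1 / 2"
    unfolding U_def by (subst AE_density) (auto split: split_indicator)
  have intU: "(\<integral>v. f v \<partial>U) = F (1/2) - F (-1/2)"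
    if "\<And>x. DERIV F x :> f x" "\<And>x. isCont f x" for F f :: "real \<Rightarrow> real"
  proof -
    have [measurable]: "f \<in> borel_measurable borel"
      using that(2) by (intro borel_measurable_continuous_onI continuous_at_imp_continuous_on) auto
    have "(\<integral>v. f v \<partial>U) = (\<integral>v. f v * indicator {-1/2..1/2} v \<partial>lborel)"
      unfolding U_def by (subst integral_density) (auto simp: mult.commute)
    also have "\<dots> = F (1/2) - F (-1/2)"
      using that by (intro integral_FTC_Icc_real) auto
    finally show ?thesis .
  qed
  define N where "N = distr (M \<Otimes>\<^sub>M U) borel (\<lambda>z. fst z + snd z)"
  have bdP: "AE z in M \<Otimes>\<^sub>M U. \<bar>fst z + snd z\<bar> \<le> real (Suc m) / 2"
  proof (rule P.AE_pair_measure)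
    show "AE x in M. AE v in U. \<bar>fst (x, v) + snd (x, v)\<bar> \<le> real (Suc m) / 2"
      using bd
    proof eventually_elim
      case (elim x)
      note x = elim
      show ?case
        using bdU
      proof eventually_elim
        case (elim v)
        with x abs_triangle_ineq[of x v] show ?case by (simp add: field_simps)
      qed
    qed
  qed measurable
  have intN: "(\<integral>x. g x \<partial>N) = (\<integral>x. (\<integral>v. g (x + v) \<partial>U) \<partial>M)"
    if [measurable]: "g \<in> borel_measurable borel" and "AE z in M \<Otimes>\<^sub>M U. \<bar>g (fst z + snd z)\<bar> \<le> B"
    for g :: "real \<Rightarrow> real" and B
  proof -
    have "integrable (M \<Otimes>\<^sub>M U) (\<lambda>z. g (fst z + snd z))"
      using that by (intro P.integrable_const_bound[of _ B]) auto
    from P.integral_fst'[OF this] show ?thesis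
      by (simp add: N_def integral_distr)
  qed
  have "prob_space N" unfolding N_def by (rule P.prob_space_distr) measurable
  moreover have "sets N = sets borel" by (simp add: N_def)
  moreover have "AE x in N. \<bar>x\<bar> \<le> real (Suc m) / 2"
    unfolding N_def using bdP by (subst AE_distr_iff) auto
  moreover have "(\<integral>x. cos (x * y) \<partial>N) = (sin (y / 2) / (y / 2)) ^ Suc m" if y: "y \<noteq> 0" for y
  proof -
    have "(\<integral>v. cos ((x + v) * y) \<partial>U) = cos (x * y) * (sin (y / 2) / (y / 2))" for x
    proof -
      have "(\<integral>v. cos ((x + v) * y) \<partial>U) = sin ((x + 1/2) * y) / y - sin ((x + -1/2) * y) / y"
        using y by (intro intU) (auto intro!: derivative_eq_intros continuous_intros)
      also have "\<dots> = cos (x * y) * (sin (y / 2) / (y / 2))"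
      proof -
        have "(x + 1/2) * y = x * y + y / 2" "(x + -1/2) * y = x * y - y / 2"
          by (simp_all add: algebra_simps)
        thus ?thesis using y by (simp only: sin_add sin_diff) (simp add: field_simps)
      qed
      finally show ?thesis .
    qed
    with y show ?thesis
      by (subst intN[of _ 1]) (auto simp: cosM)
  qed
  moreover have "(\<integral>x. x\<^sup>2 \<partial>N) = real (Suc m) / 12"
  proof -
    have inner: "(\<integral>v. (x + v)\<^sup>2 \<partial>U) = x\<^sup>2 + 1 / 12" for x
    proof -
      have "(\<integral>v. (x + v)\<^sup>2 \<partial>U) = (x + 1/2) ^ 3 / 3 - (x + -1/2) ^ 3 / 3"
        by (intro intU) (auto intro!: derivative_eq_intros continuous_intros)
      also have "\<dots> = x\<^sup>2 + 1 / 12"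
        by (simp add: power2_eq_square power3_eq_cube field_simps)
      finally show ?thesis .
    qed
    \<comment> \<open>The square is unbounded on the line; the bounded support makes it integrable,
      so that Fubini applies.\<close>
    have bd_sq: "AE z in M \<Otimes>\<^sub>M U. \<bar>(fst z + snd z)\<^sup>2\<bar> \<le> (real (Suc m) / 2)\<^sup>2"
      using bdP by eventually_elim (auto simp: abs_le_square_iff [symmetric])
    have int_sq: "integrable M (\<lambda>x. x\<^sup>2)"
    proof (rule M.integrable_const_bound[of _ "(real m / 2)\<^sup>2"])
      show "AE x in M. norm (x\<^sup>2) \<le> (real m / 2)\<^sup>2"
        using bd by eventually_elim (auto simp: abs_le_square_iff [symmetric])
    qed measurable
    have "(\<integral>x. x\<^sup>2 \<partial>N) = (\<integral>x. x\<^sup>2 + 1 / 12 \<partial>M)"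
      by (subst intN[OF _ bd_sq]) (simp_all add: inner)
    also have "\<dots> = real (Suc m) / 12"
      using int_sq by (simp add: sqM M.prob_space add_divide_distrib)
    finally show ?thesis .
  qed
  ultimately show ?case by blast
qed

text \<open>The u of the overview. By division by zero its value at 0 is 0 and not the limit 1; the
  lattice sums and integrals evaluate it only at nonzero arguments.\<close>

definition sinc_sq :: "real \<Rightarrow> real" where
  "sinc_sq y = (sin (y / 2) / (y / 2))\<^sup>2"

text \<open>The point is that a single \<open>p\<close>, independent of \<phi>, serves both the sum
  and the integral. It is the mean of \<open>\<bar>X\<bar>\<close> for the sum \<open>X\<close> of
  \<open>2 * k\<close> uniform variables.\<close>

lemma sinc_sq_power_sum_and_integral:
  obtains p :: real where
    "\<And>\<phi>. 0 < \<phi> \<Longrightarrow> real k * \<phi> \<le> 2 * pi \<Longrightarrow>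
       (\<lambda>n. (1 - sinc_sq (real (Suc n) * \<phi>) ^ k) / (real (Suc n))\<^sup>2)
         sums (pi * \<phi> * p / 2 - \<phi>\<^sup>2 * real k / 24)"
    "set_integrable lborel {0<..} (\<lambda>y. (1 - sinc_sq y ^ k) / y\<^sup>2)"
    "(LBINT y:{0<..}. (1 - sinc_sq y ^ k) / y\<^sup>2) = pi * p / 2"
proof -
  obtain M :: "real measure" where M: "prob_space M" and [measurable_cong]: "sets M = sets borel"
    and bd: "AE x in M. \<bar>x\<bar> \<le> real k"
    and cosM: "\<And>y. y \<noteq> 0 \<Longrightarrow> (\<integral>x. cos (x * y) \<partial>M) = ((sin (y / 2) / (y / 2))\<^sup>2) ^ k"
    and sqM: "(\<integral>x. x\<^sup>2 \<partial>M) = real k / 6"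
    using exists_sum_of_uniforms[of "2 * k"] by (auto simp: power_mult)
  interpret M: prob_space M by fact
  interpret P: pair_sigma_finite lborel M ..
  define p where "p = (\<integral>x. \<bar>x\<bar> \<partial>M)"
  have int_abs: "integrable M (\<lambda>x. \<bar>x\<bar>)"
    using bd by (intro M.integrable_const_bound[of _ "real k"]) auto
  have int_sq: "integrable M (\<lambda>x. x\<^sup>2)"
  proof (rule M.integrable_const_bound[of _ "(real k)\<^sup>2"])
    show "AE x in M. norm (x\<^sup>2) \<le> (real k)\<^sup>2"
      using bd by eventually_elim (auto simp: abs_le_square_iff [symmetric])
  qed measurable
  have int_cos: "integrable M (\<lambda>x. cos (x * y))" for y
    by (intro M.integrable_const_bound[of _ 1]) auto
  have int_one_minus: "(\<integral>x. (1 - cos (x * y)) / c \<partial>M) = (1 - ((sin (y / 2) / (y / 2))\<^sup>2) ^ k) / c"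
    if "y \<noteq> 0" for y c
    using that int_cos by (simp add: cosM M.prob_space)
  show ?thesis
  unfolding sinc_sq_def
  proof (rule that[of p, unfolded sinc_sq_def])
    fix \<phi> :: real assume \<phi>: "0 < \<phi>" "real k * \<phi> \<le> 2 * pi"
    let ?f = "\<lambda>n x. (1 - cos (x * (real (Suc n) * \<phi>))) / (real (Suc n))\<^sup>2"
    have nf: "norm (?f n x) \<le> 2 * (1 / (real (Suc n))\<^sup>2)" for n x
    proof -
      have "\<bar>1 - cos (x * (real (Suc n) * \<phi>))\<bar> \<le> 2"
        using cos_ge_minus_one[of "x * (real (Suc n) * \<phi>)"] cos_le_one[of "x * (real (Suc n) * \<phi>)"]
        by linarith
      thus ?thesis by (simp add: divide_right_mono del: of_nat_Suc)
    qed
    have sM: "summable (\<lambda>n. 2 * (1 / (real (Suc n))\<^sup>2))"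
      by (intro summable_mult summable_inverse_square_Suc)
    have int_f: "integrable M (?f n)" for n
      using int_cos by (intro Bochner_Integration.integrable_diff integrable_divide_zero) auto
    have "(\<lambda>n. \<integral>x. ?f n x \<partial>M) sums (\<integral>x. (\<Sum>n. ?f n x) \<partial>M)"
    proof (rule sums_integral)
      show "AE x in M. summable (\<lambda>n. norm (?f n x))"
        by (intro always_eventually allI summable_comparison_test'[OF sM]) (use nf in simp)
      show "summable (\<lambda>n. \<integral>x. norm (?f n x) \<partial>M)"
      proof (rule summable_comparison_test'[OF sM])
        fix n
        have "(\<integral>x. norm (?f n x) \<partial>M) \<le> 2 * (1 / (real (Suc n))\<^sup>2)"
          using int_f[of n] nf by (intro M.integral_le_const integrable_norm always_eventually allI)
        thus "norm (\<integral>x. norm (?f n x) \<partial>M) \<le> 2 * (1 / (real (Suc n))\<^sup>2)"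
          by simp
      qed
    qed (rule int_f)
    also have "(\<integral>x. (\<Sum>n. ?f n x) \<partial>M) = (\<integral>x. pi * \<phi> / 2 * \<bar>x\<bar> - \<phi>\<^sup>2 / 4 * x\<^sup>2 \<partial>M)"
    proof (rule integral_cong_AE)
      show "AE x in M. (\<Sum>n. ?f n x) = pi * \<phi> / 2 * \<bar>x\<bar> - \<phi>\<^sup>2 / 4 * x\<^sup>2"
        using bd
      proof eventually_elim
        case (elim x)
        have "\<bar>x\<bar> * \<phi> \<le> real k * \<phi>" using elim \<phi> by (intro mult_right_mono) auto
        hence "\<bar>x\<bar> * \<phi> \<le> 2 * pi" using \<phi>(2) by (rule order_trans)
        with \<phi>(1) have "(\<lambda>n. (1 - cos (real (Suc n) * (\<bar>x\<bar> * \<phi>))) / (real (Suc n))\<^sup>2)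
            sums (pi * (\<bar>x\<bar> * \<phi>) / 2 - (\<bar>x\<bar> * \<phi>)\<^sup>2 / 4)"
          by (intro sums_one_minus_cos_over_square) auto
        moreover have "cos (real (Suc n) * (\<bar>x\<bar> * \<phi>)) = cos (x * (real (Suc n) * \<phi>))" for n
          by (cases "x \<ge> 0") (simp_all add: mult_ac)
        ultimately show ?case by (simp add: sums_iff power_mult_distrib mult_ac)
      qed
    qed measurable
    also have "\<dots> = pi * \<phi> * p / 2 - \<phi>\<^sup>2 * real k / 24"
      using int_abs int_sq by (simp add: sqM p_def)
    also have "(\<lambda>n. \<integral>x. ?f n x \<partial>M) =
       (\<lambda>n. (1 - ((sin (real (Suc n) * \<phi> / 2) / (real (Suc n) * \<phi> / 2))\<^sup>2) ^ k) / (real (Suc n))\<^sup>2)"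
      using \<phi> by (intro ext int_one_minus) auto
    finally show "(\<lambda>n. (1 - ((sin (real (Suc n) * \<phi> / 2) / (real (Suc n) * \<phi> / 2))\<^sup>2) ^ k) / (real (Suc n))\<^sup>2)
         sums (pi * \<phi> * p / 2 - \<phi>\<^sup>2 * real k / 24)" .
  next
    let ?h = "\<lambda>y::real. (1 - ((sin (y / 2) / (y / 2))\<^sup>2) ^ k) / y\<^sup>2"
    let ?c = "\<lambda>x y. indicator {0<..} y *\<^sub>R ((1 - cos (x * y)) / y\<^sup>2) :: real"
    have p0: "p \<ge> 0" by (simp add: p_def)
    \<comment> \<open>Nonnegativity is inherited from \<open>1 - cos\<close>, of which
      \<open>?h y\<close> is a weighted mean.\<close>
    have nn: "0 \<le> ?h y" if "y > 0" for y
      using int_one_minus[of y "y\<^sup>2"] that by (metis Bochner_Integration.integral_nonneg cos_le_one diff_ge_0_iff_ge divide_nonneg_nonneg less_irrefl zero_le_power2)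
    \<comment> \<open>The order of integration is exchanged for nonnegative extended integrals,
      which asks for measurability only; finiteness of the result then gives integrability of
      \<open>?h\<close>.\<close>
    have "(\<integral>\<^sup>+ y. ennreal (indicator {0<..} y *\<^sub>R ?h y) \<partial>lborel) = (\<integral>\<^sup>+ y. \<integral>\<^sup>+ x. ennreal (?c x y) \<partial>M \<partial>lborel)"
    proof (rule nn_integral_cong)
      fix y :: real
      show "ennreal (indicator {0<..} y *\<^sub>R ?h y) = (\<integral>\<^sup>+ x. ennreal (?c x y) \<partial>M)"
      proof (cases "y > 0")
        case True
        have "(\<integral>\<^sup>+ x. ennreal ((1 - cos (x * y)) / y\<^sup>2) \<partial>M) = ennreal (?h y)"
        proof -
        have "(\<integral>\<^sup>+ x. ennreal ((1 - cos (x * y)) / y\<^sup>2) \<partial>M) = ennreal (\<integral>x. (1 - cos (x * y)) / y\<^sup>2 \<partial>M)"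
          using int_cos by (intro nn_integral_eq_integral) auto
        also have "(\<integral>x. (1 - cos (x * y)) / y\<^sup>2 \<partial>M) = ?h y"
          using True by (intro int_one_minus) simp
        finally show ?thesis .
      qed
        thus ?thesis using True by simp
      qed simp
    qed
    also have "\<dots> = (\<integral>\<^sup>+ x. \<integral>\<^sup>+ y. ennreal (?c x y) \<partial>lborel \<partial>M)"
      by (rule P.Fubini'[symmetric]) measurable
    also have "\<dots> = (\<integral>\<^sup>+ x. ennreal (pi / 2 * \<bar>x\<bar>) \<partial>M)"
    proof (rule nn_integral_cong)
      fix x :: real
      have "(\<integral>\<^sup>+ y. ennreal (?c x y) \<partial>lborel) = ennreal (\<integral>y. ?c x y \<partial>lborel)"
        using integral_one_minus_cos_over_square(1)[of x]
        by (intro nn_integral_eq_integral) (auto simp: set_integrable_def split: split_indicator)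
      also have "(\<integral>y. ?c x y \<partial>lborel) = pi / 2 * \<bar>x\<bar>"
        using integral_one_minus_cos_over_square(2)[of x] by (simp add: set_lebesgue_integral_def)
      finally show "(\<integral>\<^sup>+ y. ennreal (?c x y) \<partial>lborel) = ennreal (pi / 2 * \<bar>x\<bar>)" .
    qed
    also have "\<dots> = ennreal (pi * p / 2)"
      using int_abs by (subst nn_integral_eq_integral) (auto simp: p_def)
    finally have "has_bochner_integral lborel (\<lambda>y. indicator {0<..} y *\<^sub>R ?h y) (pi * p / 2)"
      using nn p0 by (intro has_bochner_integral_nn_integral) (auto split: split_indicator)
    thus "set_integrable lborel {0<..} ?h" "(LBINT y:{0<..}. ?h y) = pi * p / 2"
      unfolding set_integrable_def set_lebesgue_integral_def by (auto simp: has_bochner_integral_iff)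
  qed
qed

lemma sinc_sq_bounds: "0 \<le> sinc_sq y" "sinc_sq y \<le> 1"
proof -
  have "\<bar>sin (y / 2)\<bar> \<le> \<bar>y / 2\<bar>" by (rule abs_sin_x_le_abs_x)
  hence "(sin (y / 2))\<^sup>2 \<le> (y / 2)\<^sup>2" by (simp only: abs_le_square_iff)
  thus "sinc_sq y \<le> 1"
    by (cases "y = 0") (simp_all add: sinc_sq_def power_divide divide_le_eq_1)
qed (simp add: sinc_sq_def)

section \<open>Expansion in powers of the squared sinc function\<close>

text \<open>The remainder is kept exact rather than estimated, because \<open>I_f_expansion\<close>
  must subtract two of them before taking absolute values.\<close>

lemma geometric_expansion:
  fixes s u :: real
  assumes "s \<ge> 0" "u \<ge> 0"
  shows "1 / (1 + s * u) = (\<Sum>k<K. (-s) ^ k * u ^ k) + (-s) ^ K * (u ^ K / (1 + s * u))"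
proof -
  have "1 + s * u > 0" using assms by (simp add: add_pos_nonneg)
  moreover have "1 - (-s) ^ K * u ^ K = (1 + s * u) * (\<Sum>k<K. (-s) ^ k * u ^ k)"
    using one_diff_power_eq[of "(-s) * u" K] unfolding power_mult_distrib by simp
  ultimately show ?thesis
    by (simp add: field_simps)
qed

text \<open>With \<open>q = -s\<close> this is the truncated source of
  \<open>- s / (1 + s)\<^sup>2\<close>, to which the variances \<open>k / 6\<close> lead.\<close>

lemma weighted_geometric_sum:
  fixes q :: "'a :: comm_ring_1"
  shows "(1 - q)\<^sup>2 * (\<Sum>k<K. of_nat k * q ^ k) = q - of_nat K * q ^ K + (of_nat K - 1) * q ^ Suc K"
  by (induction K) (simp_all add: algebra_simps power2_eq_square)

text \<open>The value at \<open>k\<close> is the mean of \<open>\<bar>X\<bar>\<close> for a sum \<open>X\<close> of \<open>2 * k\<close> uniform variables; the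
  last clause determines it.\<close>

definition mean_abs_sum :: "nat \<Rightarrow> real" where
  "mean_abs_sum = (SOME p. \<forall>k.
     (\<forall>\<phi>>0. real k * \<phi> \<le> 2 * pi \<longrightarrow>
        (\<lambda>n. (1 - sinc_sq (real (Suc n) * \<phi>) ^ k) / (real (Suc n))\<^sup>2)
          sums (pi * \<phi> * p k / 2 - \<phi>\<^sup>2 * real k / 24)) \<and>
     set_integrable lborel {0<..} (\<lambda>y. (1 - sinc_sq y ^ k) / y\<^sup>2) \<and>
     (LBINT y:{0<..}. (1 - sinc_sq y ^ k) / y\<^sup>2) = pi * p k / 2)"

lemma
  shows sums_one_minus_sinc_sq_power:
    "\<lbrakk>0 < \<phi>; real k * \<phi> \<le> 2 * pi\<rbrakk> \<Longrightarrow>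
        (\<lambda>n. (1 - sinc_sq (real (Suc n) * \<phi>) ^ k) / (real (Suc n))\<^sup>2)
          sums (pi * \<phi> * mean_abs_sum k / 2 - \<phi>\<^sup>2 * real k / 24)"
    and set_integrable_one_minus_sinc_sq_power:
      "set_integrable lborel {0<..} (\<lambda>y. (1 - sinc_sq y ^ k) / y\<^sup>2)"
    and integral_one_minus_sinc_sq_power:
      "(LBINT y:{0<..}. (1 - sinc_sq y ^ k) / y\<^sup>2) = pi * mean_abs_sum k / 2"
proof -
  have "\<exists>p. \<forall>k. (\<forall>\<phi>>0. real k * \<phi> \<le> 2 * pi \<longrightarrow>
        (\<lambda>n. (1 - sinc_sq (real (Suc n) * \<phi>) ^ k) / (real (Suc n))\<^sup>2)
          sums (pi * \<phi> * p k / 2 - \<phi>\<^sup>2 * real k / 24)) \<and>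
     set_integrable lborel {0<..} (\<lambda>y. (1 - sinc_sq y ^ k) / y\<^sup>2) \<and>
     (LBINT y:{0<..}. (1 - sinc_sq y ^ k) / y\<^sup>2) = pi * p k / 2"
    by (intro choice allI) (rule sinc_sq_power_sum_and_integral, blast)
  from someI_ex[OF this, folded mean_abs_sum_def]
  show "\<lbrakk>0 < \<phi>; real k * \<phi> \<le> 2 * pi\<rbrakk> \<Longrightarrow>
        (\<lambda>n. (1 - sinc_sq (real (Suc n) * \<phi>) ^ k) / (real (Suc n))\<^sup>2)
          sums (pi * \<phi> * mean_abs_sum k / 2 - \<phi>\<^sup>2 * real k / 24)"
    "set_integrable lborel {0<..} (\<lambda>y. (1 - sinc_sq y ^ k) / y\<^sup>2)"
    "(LBINT y:{0<..}. (1 - sinc_sq y ^ k) / y\<^sup>2) = pi * mean_abs_sum k / 2"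
    by blast+
qed

text \<open>Here \<open>s\<close> and \<phi> are independent; they get linked only in
  \<open>Psi_estimate\<close>. Splitting \<open>u ^ k\<close> as \<open>1 - (1 - u ^ k)\<close>
  reduces the k-th sum to the Basel series and to the exact evaluation, available for all
  \<open>k < K\<close> by the hypothesis on \<open>K\<close>.\<close>

lemma lattice_sum_expansion:
  fixes s \<phi> :: real
  assumes s: "s \<ge> 0" and \<phi>: "\<phi> > 0" "real K * \<phi> \<le> 2 * pi"
  shows "\<bar>(\<Sum>n. 1 / (real (Suc n))\<^sup>2 * (1 / (1 + s * sinc_sq (real (Suc n) * \<phi>)))) -
           (\<Sum>k<K. (-s) ^ k * (pi\<^sup>2 / 6 - (pi * \<phi> * mean_abs_sum k / 2 - \<phi>\<^sup>2 * real k / 24)))\<bar>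
         \<le> s ^ K * (pi\<^sup>2 / 6)"
proof -
  define u where "u n = sinc_sq (real (Suc n) * \<phi>)" for n
  define t where "t n = 1 / (real (Suc n))\<^sup>2 * ((-s) ^ K * (u n ^ K / (1 + s * u n)))" for n
  have u: "0 \<le> u n" "u n \<le> 1" for n by (simp_all only: u_def sinc_sq_bounds)
  have pos: "1 + s * u n \<ge> 1" for n using u s by simp
  have basel: "(\<lambda>n. 1 / (real (Suc n))\<^sup>2) sums (pi\<^sup>2 / 6)"
    using inverse_squares_sums by (simp add: add.commute)
  \<comment> \<open>The denominator \<open>1 + s * u n\<close> is at least 1, so the remainder is
    bounded by \<open>s ^ K\<close> times the Basel series.\<close>
  have t: "\<bar>t n\<bar> \<le> s ^ K * (1 / (real (Suc n))\<^sup>2)" for n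
  proof -
    have "u n ^ K / (1 + s * u n) \<le> 1 / 1"
      using u[of n] pos[of n] by (intro frac_le) (auto simp: power_le_one)
    hence "1 / (real (Suc n))\<^sup>2 * (s ^ K * (u n ^ K / (1 + s * u n))) \<le> 1 / (real (Suc n))\<^sup>2 * (s ^ K * 1)"
      using s by (intro mult_left_mono) auto
    moreover have "\<bar>t n\<bar> = 1 / (real (Suc n))\<^sup>2 * (s ^ K * (u n ^ K / (1 + s * u n)))"
      unfolding t_def abs_mult power_abs using u[of n] pos[of n] s by (simp add: power_abs)
    ultimately show ?thesis by (simp add: mult_ac)
  qed
  have tail: "(\<lambda>n. s ^ K * (1 / (real (Suc n))\<^sup>2)) sums (s ^ K * (pi\<^sup>2 / 6))"
    by (intro sums_mult basel)
  have sum_t: "summable (\<lambda>n. \<bar>t n\<bar>)"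
    by (rule summable_comparison_test'[OF sums_summable[OF tail]]) (use t in auto)
  have "(\<lambda>n. (\<Sum>k<K. (-s) ^ k * (1 / (real (Suc n))\<^sup>2 - (1 - u n ^ k) / (real (Suc n))\<^sup>2)) + t n) sums
          ((\<Sum>k<K. (-s) ^ k * (pi\<^sup>2 / 6 - (pi * \<phi> * mean_abs_sum k / 2 - \<phi>\<^sup>2 * real k / 24))) + (\<Sum>n. t n))"
  proof (intro sums_add sums_sum sums_mult sums_diff basel)
    fix k assume "k \<in> {..<K}"
    hence "real k * \<phi> \<le> real K * \<phi>" using \<phi> by (intro mult_right_mono) auto
    also note \<phi>(2)
    finally show "(\<lambda>n. (1 - u n ^ k) / (real (Suc n))\<^sup>2) sums (pi * \<phi> * mean_abs_sum k / 2 - \<phi>\<^sup>2 * real k / 24)"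
      unfolding u_def using \<phi>(1) by (intro sums_one_minus_sinc_sq_power)
  qed (use sum_t in \<open>blast intro: summable_sums summable_rabs_cancel\<close>)
  moreover have "(\<Sum>k<K. (-s) ^ k * (1 / (real (Suc n))\<^sup>2 - (1 - u n ^ k) / (real (Suc n))\<^sup>2)) + t n =
      1 / (real (Suc n))\<^sup>2 * (1 / (1 + s * u n))" for n
  proof -
    have "1 / (real (Suc n))\<^sup>2 - (1 - u n ^ k) / (real (Suc n))\<^sup>2 = 1 / (real (Suc n))\<^sup>2 * u n ^ k" for k
      by (simp add: field_simps)
    thus ?thesis
      unfolding t_def geometric_expansion[OF s u(1), of n K]
      by (simp only: ring_distribs sum_distrib_left mult_ac)
  qed
  ultimately have "(\<Sum>n. 1 / (real (Suc n))\<^sup>2 * (1 / (1 + s * u n))) -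
      (\<Sum>k<K. (-s) ^ k * (pi\<^sup>2 / 6 - (pi * \<phi> * mean_abs_sum k / 2 - \<phi>\<^sup>2 * real k / 24))) = (\<Sum>n. t n)"
    by (simp add: sums_iff)
  moreover have "\<bar>\<Sum>n. t n\<bar> \<le> s ^ K * (pi\<^sup>2 / 6)"
    using summable_rabs[OF sum_t] suminf_le[OF t sum_t sums_summable[OF tail]] tail by (simp add: sums_iff)
  ultimately show ?thesis by (simp add: u_def)
qed

text \<open>The geometric expansions at \<open>u = sinc_sq y\<close> and at \<open>u = 1\<close> are
  subtracted, which produces \<open>1 - u ^ k\<close> term by term. Their remainders must stay
  together: each alone behaves like \<open>1 / y\<^sup>2\<close> at 0, while the difference is
  dominated by \<open>1 - u ^ K\<close>, whose integral is known. For \<open>K = 0\<close> that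
  majorant would vanish, whence \<open>K \<ge> 1\<close>.\<close>

lemma I_f_expansion:
  assumes s: "s \<ge> 0" and K: "K \<ge> 1"
  shows "\<bar>I_f s + (\<Sum>k<K. (-s) ^ k * (pi * mean_abs_sum k / 2))\<bar> \<le> s ^ K * (pi * mean_abs_sum K / 2)"
proof -
  define H where "H k y = indicator {0<..} y *\<^sub>R ((1 - sinc_sq y ^ k) / y\<^sup>2)" for k and y :: real
  define F where "F y = indicator {0<..} y *\<^sub>R
     (1 / (y\<^sup>2 + 4 * s * (sin (y / 2))\<^sup>2) - 1 / ((1 + s) * y\<^sup>2))" for y :: real
  define R where "R y = F y + (\<Sum>k<K. (-s) ^ k * H k y)" for y
  have H: "integrable lborel (H k)" "(\<integral>y. H k y \<partial>lborel) = pi * mean_abs_sum k / 2" for k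
    using set_integrable_one_minus_sinc_sq_power[of k] integral_one_minus_sinc_sq_power[of k]
    unfolding H_def set_integrable_def set_lebesgue_integral_def by auto
  have [measurable]: "F \<in> borel_measurable borel" unfolding F_def by measurable
  have [measurable]: "H k \<in> borel_measurable borel" for k using H(1)[of k] by simp
  have R: "\<bar>R y\<bar> \<le> s ^ K * H K y" for y
  proof (cases "y > 0")
    case True
    define u where "u = sinc_sq y"
    have u: "0 \<le> u" "u \<le> 1" unfolding u_def by (rule sinc_sq_bounds)+
    have pos: "1 + s * u \<ge> 1" using u s by simp
    have "y\<^sup>2 + 4 * s * (sin (y / 2))\<^sup>2 = y\<^sup>2 * (1 + s * u)"
      using True by (simp add: u_def sinc_sq_def field_simps power2_eq_square)
    hence "F y = 1 / (y\<^sup>2 * (1 + s * u)) - 1 / ((1 + s) * y\<^sup>2)"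
      using True by (simp add: F_def)
    also have "\<dots> = 1 / y\<^sup>2 * (1 / (1 + s * u) - 1 / (1 + s * 1))"
      by (simp add: right_diff_distrib)
    also have "\<dots> = (\<Sum>k<K. 1 / y\<^sup>2 * ((-s) ^ k * u ^ k - (-s) ^ k * 1 ^ k)) +
       1 / y\<^sup>2 * ((-s) ^ K * (u ^ K / (1 + s * u)) - (-s) ^ K * (1 ^ K / (1 + s * 1)))"
      unfolding geometric_expansion[OF s u(1), of K] geometric_expansion[OF s, of 1 K, OF zero_le_one]
      by (simp add: sum_subtractf sum_distrib_left[symmetric] algebra_simps diff_divide_distrib
         sum_divide_distrib[symmetric])
    also have "(\<Sum>k<K. 1 / y\<^sup>2 * ((-s) ^ k * u ^ k - (-s) ^ k * 1 ^ k)) = - (\<Sum>k<K. (-s) ^ k * H k y)"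
      using True unfolding sum_negf [symmetric]
      by (intro sum.cong) (simp_all add: H_def u_def field_simps)
    finally have "R y = (-s) ^ K * (1 / y\<^sup>2 * (u ^ K / (1 + s * u) - 1 / (1 + s)))"
      by (simp add: R_def algebra_simps)
    hence "\<bar>R y\<bar> = s ^ K * (1 / y\<^sup>2 * \<bar>u ^ K / (1 + s * u) - 1 / (1 + s)\<bar>)"
      using s by (simp add: abs_mult power_abs)
    also have "\<dots> \<le> s ^ K * (1 / y\<^sup>2 * (1 - u ^ K))"
    proof (intro mult_left_mono)
      obtain L where L: "K = Suc L" using K by (cases K) auto
      have uL: "u ^ L \<le> 1" "0 \<le> u ^ L" using u by (auto simp: power_le_one)
      have uK: "u ^ K \<le> u ^ L" unfolding L using u by (simp add: mult_left_le_one_le)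
      \<comment> \<open>This fixes the sign of the difference of remainders. It rests on
        \<open>u ^ K \<le> u\<close>, where \<open>K \<ge> 1\<close> enters.\<close>
      have le: "u ^ K + s * u ^ K \<le> 1 + s * u"
        unfolding L using u uL s mult_mono[of u 1 "u ^ L" 1] mult_left_mono[of "u ^ L" 1 u]
        by (intro add_mono mult_left_mono) auto
      have "\<bar>u ^ K / (1 + s * u) - 1 / (1 + s)\<bar> = \<bar>((1 + s) * u ^ K - (1 + s * u)) / ((1 + s * u) * (1 + s))\<bar>"
        using pos s by (simp add: field_simps)
      also have "\<dots> = ((1 + s * u) - (1 + s) * u ^ K) / ((1 + s * u) * (1 + s))"
      proof -
        have "(1 + s) * u ^ K - (1 + s * u) \<le> 0" using le by (simp add: algebra_simps)
        moreover have "(1 + s * u) * (1 + s) > 0" using pos s by (intro mult_pos_pos) auto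
        ultimately show ?thesis by (simp only: abs_divide abs_of_nonpos abs_of_pos) simp
      qed
      also have "\<dots> \<le> 1 - u ^ K"
      proof -
        have "(1 + s * u) - (1 + s) * u ^ K \<le> (1 - u ^ K) * (1 + s)"
          using s u mult_left_mono[of u 1 s] by (simp add: algebra_simps)
        also have "\<dots> \<le> (1 - u ^ K) * ((1 + s * u) * (1 + s))"
          using s u pos by (intro mult_left_mono) (auto simp: power_le_one)
        finally show ?thesis using pos s by (subst pos_divide_le_eq) auto
      qed
      finally show "\<bar>u ^ K / (1 + s * u) - 1 / (1 + s)\<bar> \<le> 1 - u ^ K" .
    qed (use s in auto)
    also have "\<dots> = s ^ K * H K y" using True by (simp add: H_def u_def)
    finally show ?thesis .
  qed (auto simp: R_def F_def H_def)
  have [measurable]: "R \<in> borel_measurable borel" unfolding R_def by measurable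
  have intR: "integrable lborel R"
  proof (rule Bochner_Integration.integrable_bound[of _ "\<lambda>y. s ^ K * H K y"])
    show "AE y in lborel. norm (R y) \<le> norm (s ^ K * H K y)"
      using R by (intro always_eventually allI) (auto intro: order_trans[OF _ abs_ge_self])
  qed (use H in auto)
  have "F = (\<lambda>y. R y - (\<Sum>k<K. (-s) ^ k * H k y))" by (auto simp: R_def)
  hence "(\<integral>y. F y \<partial>lborel) = (\<integral>y. R y \<partial>lborel) - (\<Sum>k<K. (-s) ^ k * (pi * mean_abs_sum k / 2))"
    using H(1) intR by (simp add: H(2))
  moreover have "I_f s = (\<integral>y. F y \<partial>lborel)"
    by (simp add: I_f_def F_def set_lebesgue_integral_def)
  ultimately have "I_f s + (\<Sum>k<K. (-s) ^ k * (pi * mean_abs_sum k / 2)) = (\<integral>y. R y \<partial>lborel)"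
    by simp
  moreover have "\<bar>\<integral>y. R y \<partial>lborel\<bar> \<le> (\<integral>y. s ^ K * H K y \<partial>lborel)"
    using intR H R by (intro order_trans[OF integral_abs_bound] integral_mono) auto
  ultimately show ?thesis using H by simp
qed

text \<open>Both bounds come from exact finite-sum identities, so they hold for every
  \<open>s \<ge> 0\<close>, including \<open>s \<ge> 1\<close>, where the infinite series
  diverge.\<close>

lemma closed_form_truncation:
  fixes s :: real
  assumes "s \<ge> 0"
  shows "\<bar>1 / (1 + s) - (\<Sum>k<K. (-s) ^ k)\<bar> \<le> s ^ K"
    and "\<bar>- s / (1 + s)\<^sup>2 - (\<Sum>k<K. real k * (-s) ^ k)\<bar> \<le> real (Suc K) * s ^ K"
proof -
  have "1 / (1 + s) - (\<Sum>k<K. (-s) ^ k) = (-s) ^ K / (1 + s)"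
    using geometric_expansion[OF assms zero_le_one, of K] by simp
  thus "\<bar>1 / (1 + s) - (\<Sum>k<K. (-s) ^ k)\<bar> \<le> s ^ K"
    using assms by (simp add: power_abs divide_le_eq mult_le_cancel_left1)
  have "(1 + s)\<^sup>2 * (- s / (1 + s)\<^sup>2 - (\<Sum>k<K. real k * (-s) ^ k)) =
      - s - (1 - (-s))\<^sup>2 * (\<Sum>k<K. real k * (-s) ^ k)"
    using assms by (simp add: right_diff_distrib)
  also have "\<dots> = (-s) ^ K * (real K + (real K - 1) * s)"
    unfolding weighted_geometric_sum by (simp add: algebra_simps)
  finally have "(1 + s)\<^sup>2 * \<bar>- s / (1 + s)\<^sup>2 - (\<Sum>k<K. real k * (-s) ^ k)\<bar> =
      s ^ K * \<bar>real K + (real K - 1) * s\<bar>"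
    using assms by (metis (no_types, lifting) abs_mult abs_of_nonneg abs_power2 power_abs abs_minus_cancel)
  also have "\<dots> \<le> s ^ K * (real (Suc K) * (1 + s)\<^sup>2)"
  proof (intro mult_left_mono)
    have "0 \<le> real K * s" "0 \<le> real K * (s * s)" "0 \<le> s * s" using assms by auto
    \<comment> \<open>The factor \<open>Suc K\<close> instead of \<open>K\<close> covers
      \<open>K = 0\<close>, where the left side is \<open>s\<close>.\<close>
    thus "\<bar>real K + (real K - 1) * s\<bar> \<le> real (Suc K) * (1 + s)\<^sup>2"
      using assms unfolding abs_le_iff by (auto simp: power2_eq_square algebra_simps)
  qed (use assms in auto)
  finally show "\<bar>- s / (1 + s)\<^sup>2 - (\<Sum>k<K. real k * (-s) ^ k)\<bar> \<le> real (Suc K) * s ^ K"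
    using assms by (simp add: mult_ac del: of_nat_Suc)
qed

section \<open>Error estimate for \<open>Psi\<close>\<close>

lemma sinc_sq_abs [simp]: "sinc_sq (a * \<bar>x\<bar>) = sinc_sq (a * x)"
  by (cases "x \<ge> 0") (simp_all add: sinc_sq_def)

text \<open>\<open>Psi\<close> is even in \<phi>. Writing it in \<open>\<bar>\<phi>\<bar>\<close>
  lets the estimates for positive \<phi> serve both one-sided limits, and the sign in front of
  \<open>I_f\<close> then comes from \<open>\<bar>\<phi>\<bar>\<close> alone.\<close>

lemma Psi_eq_lattice_sum:
  assumes "\<phi> \<noteq> 0"
  shows "Psi T0 r \<phi> = T0\<^sup>2 / (2 * pi\<^sup>2) *
    (\<Sum>n. 1 / (real (Suc n))\<^sup>2 * (1 / (1 + r\<^sup>2 * T0\<^sup>2 * \<phi>\<^sup>2 * sinc_sq (real (Suc n) * \<bar>\<phi>\<bar>))))"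
proof -
  define a where "a n = 1 / (real (Suc n))\<^sup>2 * (1 / (1 + r\<^sup>2 * T0\<^sup>2 * \<phi>\<^sup>2 * sinc_sq (real (Suc n) * \<bar>\<phi>\<bar>)))" for n
  have "T0\<^sup>2 / ((real (Suc n))\<^sup>2 + 4 * (sin (real (Suc n) * \<phi> / 2))\<^sup>2 * T0\<^sup>2 * r\<^sup>2) = T0\<^sup>2 * a n" for n
  proof -
    have "(real (Suc n))\<^sup>2 + 4 * (sin (real (Suc n) * \<phi> / 2))\<^sup>2 * T0\<^sup>2 * r\<^sup>2 =
        (real (Suc n))\<^sup>2 * (1 + r\<^sup>2 * T0\<^sup>2 * \<phi>\<^sup>2 * sinc_sq (real (Suc n) * \<bar>\<phi>\<bar>))"
      unfolding sinc_sq_abs using assms by (simp add: sinc_sq_def field_simps power2_eq_square del: of_nat_Suc)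
    thus ?thesis by (simp add: a_def del: of_nat_Suc)
  qed
  moreover have "summable a"
  proof (rule summable_comparison_test'[OF summable_inverse_square_Suc])
    fix n
    have nonneg: "0 \<le> r\<^sup>2 * T0\<^sup>2 * \<phi>\<^sup>2 * sinc_sq (real (Suc n) * \<bar>\<phi>\<bar>)"
      by (intro mult_nonneg_nonneg sinc_sq_bounds) auto
    hence "1 / (1 + r\<^sup>2 * T0\<^sup>2 * \<phi>\<^sup>2 * sinc_sq (real (Suc n) * \<bar>\<phi>\<bar>)) \<le> 1 / 1"
      by (intro frac_le) linarith+
    hence "a n \<le> 1 / (real (Suc n))\<^sup>2 * (1 / 1)"
      unfolding a_def by (intro mult_left_mono) auto
    moreover have "a n \<ge> 0"
      unfolding a_def using nonneg by (intro mult_nonneg_nonneg divide_nonneg_nonneg zero_le_power2) linarith+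
    ultimately show "norm (a n) \<le> 1 / (real (Suc n))\<^sup>2" by simp
  qed
  ultimately have "Psi T0 r \<phi> = T0\<^sup>2 / (2 * pi\<^sup>2) * suminf a"
    unfolding Psi_def by (simp only: suminf_mult) simp
  thus ?thesis by (simp only: a_def [abs_def])
qed

lemma Psi_estimate:
  assumes K: "K \<ge> 1"
  obtains C where "\<And>\<phi>. \<lbrakk>\<phi> \<noteq> 0; real K * \<bar>\<phi>\<bar> \<le> 2 * pi\<rbrakk> \<Longrightarrow>
    \<bar>Psi T0 r \<phi> -
       (1 / 12 * (T0\<^sup>2 / (1 + r\<^sup>2 * T0\<^sup>2 * \<phi>\<^sup>2))
        - r\<^sup>2 * T0 ^ 4 * \<phi> ^ 4 / (48 * pi\<^sup>2 * (1 + r\<^sup>2 * T0\<^sup>2 * \<phi>\<^sup>2)\<^sup>2)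
        + I_f (r\<^sup>2 * T0\<^sup>2 * \<phi>\<^sup>2) * (\<bar>\<phi>\<bar> * T0\<^sup>2 / (2 * pi\<^sup>2)))\<bar> \<le> C * \<bar>\<phi>\<bar> ^ (2 * K)"
proof
  define c where "c = T0\<^sup>2 / (2 * pi\<^sup>2)"
  define p where "p = pi * mean_abs_sum K / 2"
  \<comment> \<open>The four summands bound the errors \<open>E\<close>, \<open>G1\<close>,
    \<open>G2\<close> and \<open>J\<close> below, with their prefactors; for the last two,
    \<open>x \<le> 2 * pi\<close> is inserted.\<close>
  define B where "B = pi\<^sup>2 / 6 + pi\<^sup>2 / 6 * 1 + (2 * pi)\<^sup>2 / 24 * real (Suc K) + 2 * pi * p"
  fix \<phi> :: real assume \<phi>: "\<phi> \<noteq> 0" "real K * \<bar>\<phi>\<bar> \<le> 2 * pi"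
  define s where "s = r\<^sup>2 * T0\<^sup>2 * \<phi>\<^sup>2"
  define x where "x = \<bar>\<phi>\<bar>"
  have s: "s \<ge> 0" by (simp add: s_def)
  have x: "x > 0" "real K * x \<le> 2 * pi" using \<phi> by (auto simp: x_def)
  have "1 * x \<le> real K * x" using K x(1) by (intro mult_right_mono) auto
  hence x2: "x \<le> 2 * pi" using x(2) by simp
  define S where "S = (\<Sum>n. 1 / (real (Suc n))\<^sup>2 * (1 / (1 + s * sinc_sq (real (Suc n) * x))))"
  define E where "E = S - (\<Sum>k<K. (-s) ^ k * (pi\<^sup>2 / 6 - (pi * x * mean_abs_sum k / 2 - x\<^sup>2 * real k / 24)))"
  define J where "J = I_f s + (\<Sum>k<K. (-s) ^ k * (pi * mean_abs_sum k / 2))"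
  define G1 where "G1 = 1 / (1 + s) - (\<Sum>k<K. (-s) ^ k)"
  define G2 where "G2 = - s / (1 + s)\<^sup>2 - (\<Sum>k<K. real k * (-s) ^ k)"
  have E: "\<bar>E\<bar> \<le> s ^ K * (pi\<^sup>2 / 6)"
    unfolding E_def S_def using lattice_sum_expansion[OF s x] .
  have J: "\<bar>J\<bar> \<le> s ^ K * p"
    unfolding J_def p_def using I_f_expansion[OF s K] .
  have G1: "\<bar>G1\<bar> \<le> s ^ K" and G2: "\<bar>G2\<bar> \<le> real (Suc K) * s ^ K"
    unfolding G1_def G2_def using closed_form_truncation[OF s] by blast+
  \<comment> \<open>The sums over \<open>mean_abs_sum\<close> in \<open>E\<close> and in
    \<open>x * J\<close> cancel here, which is how the unknown means turn into
    \<open>I_f\<close>.\<close>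
  have "S - pi\<^sup>2 / 6 * (1 / (1 + s)) - x\<^sup>2 / 24 * (- s / (1 + s)\<^sup>2) - x * I_f s =
      E - pi\<^sup>2 / 6 * G1 - x\<^sup>2 / 24 * G2 - x * J"
  proof -
    have "(\<Sum>k<K. (-s) ^ k * (pi\<^sup>2 / 6 - (pi * x * mean_abs_sum k / 2 - x\<^sup>2 * real k / 24))) =
      pi\<^sup>2 / 6 * (\<Sum>k<K. (-s) ^ k) - x * (\<Sum>k<K. (-s) ^ k * (pi * mean_abs_sum k / 2)) +
      x\<^sup>2 / 24 * (\<Sum>k<K. real k * (-s) ^ k)"
      unfolding sum_distrib_left sum_subtractf [symmetric] sum.distrib [symmetric]
      by (intro sum.cong refl) (simp add: field_simps)
    thus ?thesis by (simp add: E_def J_def G1_def G2_def right_diff_distrib distrib_left)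
  qed
  moreover have "\<bar>E - pi\<^sup>2 / 6 * G1 - x\<^sup>2 / 24 * G2 - x * J\<bar> \<le> s ^ K * B"
  proof -
    have "\<bar>pi\<^sup>2 / 6 * G1\<bar> \<le> pi\<^sup>2 / 6 * s ^ K"
      using G1 by (simp add: abs_mult mult_left_mono)
    moreover have "\<bar>x\<^sup>2 / 24 * G2\<bar> \<le> (2 * pi)\<^sup>2 / 24 * (real (Suc K) * s ^ K)"
    proof -
      have "x\<^sup>2 / 24 \<le> (2 * pi)\<^sup>2 / 24" using power_mono[OF x2, of 2] x(1) by simp
      hence "x\<^sup>2 / 24 * \<bar>G2\<bar> \<le> (2 * pi)\<^sup>2 / 24 * (real (Suc K) * s ^ K)"
        using G2 by (rule mult_mono) auto
      thus ?thesis by (simp add: abs_mult del: of_nat_Suc)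
    qed
    moreover have "\<bar>x * J\<bar> \<le> 2 * pi * (s ^ K * p)"
      unfolding abs_mult using J x(1) x2 s by (intro mult_mono) auto
    moreover have "s ^ K * B = s ^ K * (pi\<^sup>2 / 6) + pi\<^sup>2 / 6 * s ^ K +
        (2 * pi)\<^sup>2 / 24 * (real (Suc K) * s ^ K) + 2 * pi * (s ^ K * p)"
      unfolding B_def by (simp only: distrib_left mult_1_right mult_ac)
    ultimately show ?thesis using E by linarith
  qed
  ultimately have "\<bar>S - pi\<^sup>2 / 6 * (1 / (1 + s)) - x\<^sup>2 / 24 * (- s / (1 + s)\<^sup>2) - x * I_f s\<bar> \<le> s ^ K * B"
    by simp
  moreover have "c \<ge> 0" by (simp add: c_def)
  ultimately have "c * \<bar>S - pi\<^sup>2 / 6 * (1 / (1 + s)) - x\<^sup>2 / 24 * (- s / (1 + s)\<^sup>2) - x * I_f s\<bar> \<le> c * (s ^ K * B)"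
    by (rule mult_left_mono)
  also have "s ^ K = (r\<^sup>2 * T0\<^sup>2) ^ K * \<bar>\<phi>\<bar> ^ (2 * K)"
    by (simp add: s_def power_mult_distrib power_mult)
  finally have "\<bar>c * (S - pi\<^sup>2 / 6 * (1 / (1 + s)) - x\<^sup>2 / 24 * (- s / (1 + s)\<^sup>2) - x * I_f s)\<bar> \<le>
      c * (r\<^sup>2 * T0\<^sup>2) ^ K * B * \<bar>\<phi>\<bar> ^ (2 * K)"
    using \<open>c \<ge> 0\<close> by (simp add: abs_mult mult_ac)
  moreover have "c * (S - pi\<^sup>2 / 6 * (1 / (1 + s)) - x\<^sup>2 / 24 * (- s / (1 + s)\<^sup>2) - x * I_f s) =
      c * S - (1 / 12 * (T0\<^sup>2 / (1 + s)) - r\<^sup>2 * T0 ^ 4 * \<phi> ^ 4 / (48 * pi\<^sup>2 * (1 + s)\<^sup>2)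
        + I_f s * (x * T0\<^sup>2 / (2 * pi\<^sup>2)))"
  proof -
    have "c * (pi\<^sup>2 / 6 * (1 / (1 + s))) = 1 / 12 * (T0\<^sup>2 / (1 + s))"
      by (simp add: c_def field_simps)
    moreover have "c * (x\<^sup>2 / 24 * (- s / (1 + s)\<^sup>2)) = - (r\<^sup>2 * T0 ^ 4 * \<phi> ^ 4 / (48 * pi\<^sup>2 * (1 + s)\<^sup>2))"
    proof -
      have "T0\<^sup>2 * (x\<^sup>2 * s) = r\<^sup>2 * T0 ^ 4 * \<phi> ^ 4"
        by (simp add: x_def s_def power2_eq_square power4_eq_xxxx)
      thus ?thesis by (simp add: c_def)
    qed
    moreover have "c * (x * I_f s) = I_f s * (x * T0\<^sup>2 / (2 * pi\<^sup>2))"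
      by (simp add: c_def)
    ultimately show ?thesis by (simp only: right_diff_distrib)
  qed
  ultimately have "\<bar>c * S - (1 / 12 * (T0\<^sup>2 / (1 + s)) - r\<^sup>2 * T0 ^ 4 * \<phi> ^ 4 / (48 * pi\<^sup>2 * (1 + s)\<^sup>2)
        + I_f s * (x * T0\<^sup>2 / (2 * pi\<^sup>2)))\<bar> \<le> c * (r\<^sup>2 * T0\<^sup>2) ^ K * B * \<bar>\<phi>\<bar> ^ (2 * K)"
    by (simp only:)
  moreover have Psi: "Psi T0 r \<phi> = c * S"
    unfolding Psi_eq_lattice_sum[OF \<phi>(1)] S_def c_def s_def x_def ..
  ultimately show "\<bar>Psi T0 r \<phi> -
       (1 / 12 * (T0\<^sup>2 / (1 + r\<^sup>2 * T0\<^sup>2 * \<phi>\<^sup>2))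
        - r\<^sup>2 * T0 ^ 4 * \<phi> ^ 4 / (48 * pi\<^sup>2 * (1 + r\<^sup>2 * T0\<^sup>2 * \<phi>\<^sup>2)\<^sup>2)
        + I_f (r\<^sup>2 * T0\<^sup>2 * \<phi>\<^sup>2) * (\<bar>\<phi>\<bar> * T0\<^sup>2 / (2 * pi\<^sup>2)))\<bar> \<le>
      c * (r\<^sup>2 * T0\<^sup>2) ^ K * B * \<bar>\<phi>\<bar> ^ (2 * K)"
    by (simp only: Psi s_def x_def)
qed

lemma Psi_remainder_bigo:
  assumes F: "F \<le> at (0::real)"
  shows "(\<lambda>\<phi>. Psi T0 r \<phi> -
       (1 / 12 * (T0\<^sup>2 / (1 + r\<^sup>2 * T0\<^sup>2 * \<phi>\<^sup>2))
        - r\<^sup>2 * T0 ^ 4 * \<phi> ^ 4 / (48 * pi\<^sup>2 * (1 + r\<^sup>2 * T0\<^sup>2 * \<phi>\<^sup>2)\<^sup>2)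
        + I_f (r\<^sup>2 * T0\<^sup>2 * \<phi>\<^sup>2) * (\<bar>\<phi>\<bar> * T0\<^sup>2 / (2 * pi\<^sup>2)))) \<in> O[F](\<lambda>\<phi>. \<bar>\<phi>\<bar> ^ N)"
proof -
  obtain C where C: "\<And>\<phi>. \<lbrakk>\<phi> \<noteq> 0; real (Suc N) * \<bar>\<phi>\<bar> \<le> 2 * pi\<rbrakk> \<Longrightarrow>
    \<bar>Psi T0 r \<phi> -
       (1 / 12 * (T0\<^sup>2 / (1 + r\<^sup>2 * T0\<^sup>2 * \<phi>\<^sup>2))
        - r\<^sup>2 * T0 ^ 4 * \<phi> ^ 4 / (48 * pi\<^sup>2 * (1 + r\<^sup>2 * T0\<^sup>2 * \<phi>\<^sup>2)\<^sup>2)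
        + I_f (r\<^sup>2 * T0\<^sup>2 * \<phi>\<^sup>2) * (\<bar>\<phi>\<bar> * T0\<^sup>2 / (2 * pi\<^sup>2)))\<bar> \<le> C * \<bar>\<phi>\<bar> ^ (2 * Suc N)"
    by (rule Psi_estimate[of "Suc N" T0 r]) (simp, blast)
  \<comment> \<open>This neighbourhood gives both \<open>K * \<bar>\<phi>\<bar> \<le> 2 * pi\<close>
    for \<open>K = Suc N\<close> and \<open>\<bar>\<phi>\<bar> \<le> 1\<close>, so that the exponent
    \<open>2 * K\<close> may be lowered to \<open>N\<close>.\<close>
  have "eventually (\<lambda>\<phi>. \<bar>\<phi>\<bar> < 1 / real (Suc N) \<and> \<phi> \<noteq> 0) (at (0::real))"
    by (auto simp: eventually_at intro!: exI[of _ "1 / real (Suc N)"])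
  hence "eventually (\<lambda>\<phi>. \<bar>\<phi>\<bar> < 1 / real (Suc N) \<and> \<phi> \<noteq> 0) F"
    using F by (rule filter_leD[rotated])
  thus ?thesis
  proof (intro bigoI[of _ "\<bar>C\<bar>"], elim eventually_mono)
    fix \<phi> :: real assume \<phi>: "\<bar>\<phi>\<bar> < 1 / real (Suc N) \<and> \<phi> \<noteq> 0"
    hence *: "real (Suc N) * \<bar>\<phi>\<bar> \<le> 1" by (simp add: field_simps)
    have "1 * \<bar>\<phi>\<bar> \<le> real (Suc N) * \<bar>\<phi>\<bar>" by (intro mult_right_mono) auto
    hence "\<bar>\<phi>\<bar> \<le> 1" using * by linarith
    hence "\<bar>\<phi>\<bar> ^ (2 * Suc N) \<le> \<bar>\<phi>\<bar> ^ N" by (intro power_decreasing) auto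
    hence "C * \<bar>\<phi>\<bar> ^ (2 * Suc N) \<le> \<bar>C\<bar> * \<bar>\<phi>\<bar> ^ N" by (intro mult_mono) auto
    moreover have "real (Suc N) * \<bar>\<phi>\<bar> \<le> 2 * pi" using * pi_gt3 by linarith
    ultimately show "norm (Psi T0 r \<phi> -
       (1 / 12 * (T0\<^sup>2 / (1 + r\<^sup>2 * T0\<^sup>2 * \<phi>\<^sup>2))
        - r\<^sup>2 * T0 ^ 4 * \<phi> ^ 4 / (48 * pi\<^sup>2 * (1 + r\<^sup>2 * T0\<^sup>2 * \<phi>\<^sup>2)\<^sup>2)
        + I_f (r\<^sup>2 * T0\<^sup>2 * \<phi>\<^sup>2) * (\<bar>\<phi>\<bar> * T0\<^sup>2 / (2 * pi\<^sup>2)))) \<le> \<bar>C\<bar> * norm (\<bar>\<phi>\<bar> ^ N)"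
      using C[of \<phi>] \<phi> by (simp add: power_abs del: of_nat_Suc mult_Suc_right)
  qed
qed

section \<open>Power expansions and the distillate\<close>

text \<open>A working form of \<open>asymptotic_series\<close> with natural exponents and O-errors,
  which is easily added and scaled; it is converted back once, in
  \<open>power_expansion_imp_asymptotic_series\<close>.\<close>

definition power_expansion :: "(real \<Rightarrow> complex) \<Rightarrow> (nat \<Rightarrow> complex) \<Rightarrow> real filter \<Rightarrow> bool" where
  "power_expansion f a F \<longleftrightarrow>
     (\<forall>N. (\<lambda>x. f x - (\<Sum>n<N. a n * of_real x ^ n)) \<in> O[F](\<lambda>x. of_real x ^ N))"

lemma power_bigo_power:
  assumes "F \<le> at (0::real)" "N \<le> M"
  shows "(\<lambda>x. complex_of_real x ^ M) \<in> O[F](\<lambda>x. of_real x ^ N)"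
proof (intro bigoI[of _ 1])
  have "eventually (\<lambda>x. \<bar>x\<bar> \<le> 1) (at (0::real))"
    by (auto simp: eventually_at intro!: exI[of _ 1])
  hence "eventually (\<lambda>x. \<bar>x\<bar> \<le> 1) F"
    using assms(1) by (rule filter_leD[rotated])
  thus "\<forall>\<^sub>F x in F. norm (complex_of_real x ^ M) \<le> 1 * norm (complex_of_real x ^ N)"
    by eventually_elim (use assms(2) in \<open>simp add: norm_power power_decreasing\<close>)
qed

text \<open>Meant for \<open>I_f\<close>, whose expansion is naturally cut at even orders: an error
  bound at order M implies the bounds at all lower orders, since the terms in between are
  O(x^N).\<close>

lemma power_expansionI_cofinal:
  assumes F: "F \<le> at (0::real)"
    and "\<And>N. \<exists>M\<ge>N. (\<lambda>x. f x - (\<Sum>n<M. a n * of_real x ^ n)) \<in> O[F](\<lambda>x. of_real x ^ M)"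
  shows "power_expansion f a F"
  unfolding power_expansion_def
proof
  fix N
  obtain M where M: "N \<le> M"
    "(\<lambda>x. f x - (\<Sum>n<M. a n * of_real x ^ n)) \<in> O[F](\<lambda>x. of_real x ^ M)"
    using assms(2) by blast
  have 1: "(\<lambda>x. f x - (\<Sum>n<M. a n * of_real x ^ n)) \<in> O[F](\<lambda>x. of_real x ^ N)"
    using M(2) power_bigo_power[OF F M(1)] by (rule landau_o.big_trans)
  have 2: "(\<lambda>x. \<Sum>n\<in>{N..<M}. a n * of_real x ^ n) \<in> O[F](\<lambda>x. of_real x ^ N)"
  proof (rule big_sum_in_bigo)
    show "(\<lambda>x. a n * complex_of_real x ^ n) \<in> O[F](\<lambda>x. of_real x ^ N)" if "n \<in> {N..<M}" for n
      using power_bigo_power[OF F, of N n] that by (cases "a n = 0") auto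
  qed
  note sum_in_bigo(1)[OF 1 2]
  moreover have "(\<Sum>n<M. a n * of_real x ^ n) =
      (\<Sum>n<N. a n * of_real x ^ n) + (\<Sum>n\<in>{N..<M}. a n * of_real x ^ n)" for x
    using M(1) by (subst sum.union_disjoint [symmetric]) (auto intro!: sum.cong)
  ultimately show "(\<lambda>x. f x - (\<Sum>n<N. a n * of_real x ^ n)) \<in> O[F](\<lambda>x. of_real x ^ N)"
    by (simp add: algebra_simps)
qed

lemma power_expansion_add:
  assumes "power_expansion f a F" "power_expansion g b F"
  shows "power_expansion (\<lambda>x. f x + g x) (\<lambda>n. a n + b n) F"
  unfolding power_expansion_def
proof
  fix N
  have "(\<lambda>x. (f x - (\<Sum>n<N. a n * of_real x ^ n)) + (g x - (\<Sum>n<N. b n * of_real x ^ n)))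
      \<in> O[F](\<lambda>x. of_real x ^ N)"
    by (rule sum_in_bigo(1)[OF assms[unfolded power_expansion_def, rule_format]])
  thus "(\<lambda>x. f x + g x - (\<Sum>n<N. (a n + b n) * of_real x ^ n)) \<in> O[F](\<lambda>x. of_real x ^ N)"
    by (simp add: sum.distrib algebra_simps)
qed

lemma power_expansion_cmult:
  assumes "power_expansion f a F"
  shows "power_expansion (\<lambda>x. c * f x) (\<lambda>n. c * a n) F"
  unfolding power_expansion_def
proof
  fix N
  have "(\<lambda>x. c * (f x - (\<Sum>n<N. a n * of_real x ^ n))) \<in> O[F](\<lambda>x. of_real x ^ N)"
    using assms unfolding power_expansion_def by (cases "c = 0") auto
  thus "(\<lambda>x. c * f x - (\<Sum>n<N. c * a n * of_real x ^ n)) \<in> O[F](\<lambda>x. of_real x ^ N)"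
    by (simp add: right_diff_distrib sum_distrib_left mult.assoc)
qed

lemma power_expansion_perturb:
  assumes "power_expansion f a F"
    and "\<And>N. (\<lambda>x. g x - f x) \<in> O[F](\<lambda>x. of_real x ^ N)"
  shows "power_expansion g a F"
  unfolding power_expansion_def
proof
  fix N
  have "(\<lambda>x. (g x - f x) + (f x - (\<Sum>n<N. a n * of_real x ^ n))) \<in> O[F](\<lambda>x. of_real x ^ N)"
    by (rule sum_in_bigo(1)[OF assms(2) assms(1)[unfolded power_expansion_def, rule_format]])
  thus "(\<lambda>x. g x - (\<Sum>n<N. a n * of_real x ^ n)) \<in> O[F](\<lambda>x. of_real x ^ N)"
    by simp
qed

text \<open>Removing the Taylor polynomial leaves a series of subdegree at least \<open>N\<close>.
  Shifting it shows that the quotient by \<open>z ^ N\<close> has a limit at 0, hence is bounded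
  there.\<close>

lemma has_fps_expansion_imp_bigo_remainder:
  fixes f :: "complex \<Rightarrow> complex"
  assumes "f has_fps_expansion G"
  shows "(\<lambda>z. f z - (\<Sum>n<N. fps_nth G n * z ^ n)) \<in> O[at 0](\<lambda>z. z ^ N)"
proof -
  define H where "H = G - (\<Sum>n<N. fps_const (fps_nth G n) * fps_X ^ n)"
  define h where "h z = f z - (\<Sum>n<N. fps_nth G n * z ^ n)" for z
  have h: "h has_fps_expansion H"
    unfolding h_def [abs_def] H_def using assms
    by (intro fps_expansion_intros) auto
  have H0: "fps_nth H i = 0" if "i < N" for i
    using that by (simp add: H_def fps_sum_nth fps_X_power_nth sum.delta if_distrib cong: if_cong)
  have "\<exists>c. ((\<lambda>z. h z / z ^ N) \<longlongrightarrow> c) (at 0)"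
  \<comment> \<open>The zero series has subdegree 0 by convention, so the shift argument cannot
    cover it.\<close>
  proof (cases "H = 0")
    case True
    hence "eventually (\<lambda>z. h z = 0) (nhds 0)"
      using h by (auto simp: has_fps_expansion_def elim!: eventually_mono)
    hence "eventually (\<lambda>z. h z / z ^ N = 0) (at 0)"
      by (auto simp: eventually_at_filter elim!: eventually_mono)
    thus ?thesis by (blast intro: tendsto_eventually)
  next
    case False
    hence "N \<le> subdegree H" using H0 by (intro subdegree_geI) auto
    from has_fps_expansion_imp_continuous[OF has_fps_expansion_shift[OF h this refl], of UNIV]
    have "((\<lambda>z. if z = 0 then fps_nth H N else h z / z ^ N) \<longlongrightarrow> fps_nth H N) (at 0)"
      by (simp add: continuous_within)
    hence "((\<lambda>z. h z / z ^ N) \<longlongrightarrow> fps_nth H N) (at 0)"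
      by (rule Lim_transform_eventually) (auto simp: eventually_at_filter)
    thus ?thesis by blast
  qed
  then obtain c where "((\<lambda>z. h z / z ^ N) \<longlongrightarrow> c) (at 0)" ..
  moreover have "eventually (\<lambda>z::complex. z ^ N \<noteq> 0) (at 0)"
    by (rule eventually_mono[OF eventually_neq_at_within[of 0 0]]) simp
  ultimately show ?thesis
    unfolding h_def by (rule bigoI_tendsto)
qed

lemma has_fps_expansion_imp_power_expansion:
  fixes f :: "complex \<Rightarrow> complex"
  assumes "f has_fps_expansion G" and F: "F \<le> at 0"
  shows "power_expansion (\<lambda>x. f (of_real x)) (fps_nth G) F"
proof -
  have "filterlim complex_of_real (at 0) (at 0)"
    unfolding filterlim_at by (auto intro!: tendsto_eq_intros simp: eventually_at_filter)
  hence lim: "filterlim complex_of_real (at 0) F"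
    using F by (rule filterlim_mono[OF _ order_refl])
  show ?thesis
    unfolding power_expansion_def
    using landau_o.big.compose[OF has_fps_expansion_imp_bigo_remainder[OF assms(1)] lim] by blast
qed

text \<open>Keeping one term more turns O into o: after the term of order N the error is O(x^(N+1)).
  For negative N the sum is empty, and boundedness of \<open>f\<close> suffices.\<close>

lemma power_expansion_imp_asymptotic_series:
  assumes ex: "power_expansion f a F" and F: "F \<le> at 0"
  shows "asymptotic_series f (fps_to_fls (Abs_fps a)) F"
  unfolding asymptotic_series_def
proof
  fix N :: int
  let ?A = "fps_to_fls (Abs_fps a)"
  have sub: "fls_subdegree ?A \<ge> 0" by (rule fls_subdegree_fls_to_fps_gt0)
  have nz: "eventually (\<lambda>x. x \<noteq> 0) F"
    by (rule filter_leD[OF F]) (simp add: eventually_at_filter)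
  have id: "((\<lambda>x. complex_of_real x) \<longlongrightarrow> 0) F"
    by (rule tendsto_mono[OF F]) (auto intro!: tendsto_eq_intros)
  have small: "(\<lambda>x. complex_of_real x ^ m) \<in> o[F](\<lambda>x. of_real x powi M)" if lt: "M < int m" for m M
  proof (rule smalloI_tendsto)
    obtain j where j: "int m = M + int (Suc j)"
      using lt unfolding zless_iff_Suc_zadd by blast
    have "complex_of_real x ^ Suc j = complex_of_real x ^ m / of_real x powi M" if "x \<noteq> 0" for x
    proof -
      have "complex_of_real x powi int m = complex_of_real x powi M * complex_of_real x powi int (Suc j)"
        unfolding j using that by (intro power_int_add) simp
      hence "complex_of_real x ^ m = complex_of_real x powi M * complex_of_real x ^ Suc j"
        by (simp only: power_int_of_nat)
      thus ?thesis using that by simp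
    qed
    hence "eventually (\<lambda>x. complex_of_real x ^ Suc j = complex_of_real x ^ m / of_real x powi M) F"
      using nz by (auto elim!: eventually_mono)
    moreover have "((\<lambda>x. complex_of_real x ^ Suc j) \<longlongrightarrow> 0) F"
      using tendsto_power[OF id, of "Suc j"] by simp
    ultimately show "((\<lambda>x. complex_of_real x ^ m / of_real x powi M) \<longlongrightarrow> 0) F"
      by (rule Lim_transform_eventually[rotated])
    show "eventually (\<lambda>x. complex_of_real x powi M \<noteq> 0) F"
      using nz by eventually_elim simp
  qed
  show "(\<lambda>x. f x - (\<Sum>n = fls_subdegree ?A..N. fls_nth ?A n * complex_of_real x powi n))
       \<in> o[F](\<lambda>x. complex_of_real x powi N)"
  proof (cases "N < 0")
    case True
    have one: "(\<lambda>x. 1) \<in> o[F](\<lambda>x. complex_of_real x powi N)"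
      using small[of N 0] True by simp
    have "f \<in> O[F](\<lambda>x. 1)"
      using ex[unfolded power_expansion_def, rule_format, of 0] by simp
    from landau_o.big_small_trans[OF this one] show ?thesis
      using True sub by simp
  next
    case False
    then obtain m where m: "N = int m" by (metis nonneg_int_cases not_less)
    have "(\<Sum>n = fls_subdegree ?A..N. fls_nth ?A n * complex_of_real x powi n) =
        (\<Sum>n<Suc m. a n * of_real x ^ n)" for x
    proof -
      \<comment> \<open>If leading coefficients vanish, the subdegree exceeds 0 and may even exceed
        \<open>N\<close>; the terms added by starting at 0 are zero.\<close>
      have "(\<Sum>n = fls_subdegree ?A..N. fls_nth ?A n * complex_of_real x powi n) =
          (\<Sum>n = 0..N. fls_nth ?A n * complex_of_real x powi n)"
      proof (rule sum.mono_neutral_left)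
        show "\<forall>i\<in>{0..N} - {fls_subdegree ?A..N}. fls_nth ?A i * complex_of_real x powi i = 0"
        proof
          fix i assume "i \<in> {0..N} - {fls_subdegree ?A..N}"
          hence "fls_nth ?A i = 0" by (intro fls_eq0_below_subdegree) auto
          thus "fls_nth ?A i * complex_of_real x powi i = 0" by (simp only: mult_zero_left)
        qed
      qed (use sub in auto)
      also have "\<dots> = (\<Sum>n<Suc m. a n * of_real x ^ n)"
        by (rule sum.reindex_bij_witness[of _ int nat]) (auto simp: m power_int_def)
      finally show ?thesis .
    qed
    moreover have "(\<lambda>x. f x - (\<Sum>n<Suc m. a n * of_real x ^ n)) \<in> o[F](\<lambda>x. complex_of_real x powi N)"
      by (rule landau_o.big_small_trans[OF ex[unfolded power_expansion_def, rule_format] small]) (simp add: m)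
    ultimately show ?thesis by simp
  qed
qed

section \<open>The odd part of the expansion and the coefficients common to both sides\<close>

definition odd_coeff :: "real \<Rightarrow> nat \<Rightarrow> complex" where
  "odd_coeff w n = (if even n then 0 else of_real ((-w) ^ (n div 2) * (- (pi * mean_abs_sum (n div 2) / 2))))"

lemma sum_odd_coeff:
  "(\<Sum>n<2 * K. odd_coeff w n * of_real x ^ n) =
     of_real (x * (\<Sum>k<K. (- (w * x\<^sup>2)) ^ k * (- (pi * mean_abs_sum k / 2))))"
proof (induction K)
  case (Suc K)
  have "odd_coeff w (2 * K) = 0"
    "odd_coeff w (Suc (2 * K)) = of_real ((-w) ^ K * (- (pi * mean_abs_sum K / 2)))"
    by (simp_all add: odd_coeff_def)
  moreover have "(- (w * x\<^sup>2)) ^ K = (-w) ^ K * x ^ (2 * K)"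
    by (metis mult_minus_left power_mult power_mult_distrib)
  ultimately show ?case
    using Suc.IH by (simp add: distrib_left right_diff_distrib mult_ac)
qed simp

text \<open>With \<open>s = w * x\<^sup>2\<close>, the k-th term of \<open>I_f_expansion\<close>
  times \<open>x\<close> sits at exponent \<open>2 * k + 1\<close>. The bound on its remainder is
  already the expansion, so no derivative of \<open>I_f\<close> at 0 is taken.\<close>

lemma odd_part_expansion:
  assumes w: "w \<ge> 0" and F: "F \<le> at 0"
  shows "power_expansion (\<lambda>x. complex_of_real (x * I_f (w * x\<^sup>2))) (odd_coeff w) F"
proof (rule power_expansionI_cofinal[OF F])
  fix N
  define K where "K = Suc N"
  define p where "p = pi * mean_abs_sum K / 2"
  have "eventually (\<lambda>x. \<bar>x\<bar> \<le> 1) (at (0::real))"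
    by (auto simp: eventually_at intro!: exI[of _ 1])
  hence ev: "eventually (\<lambda>x. \<bar>x\<bar> \<le> 1) F"
    using F by (rule filter_leD[rotated])
  have "(\<lambda>x. complex_of_real (x * I_f (w * x\<^sup>2)) - (\<Sum>n<2 * K. odd_coeff w n * of_real x ^ n))
      \<in> O[F](\<lambda>x. of_real x ^ (2 * K))"
  proof (rule bigoI[of _ "w ^ K * p"])
    show "\<forall>\<^sub>F x in F. norm (complex_of_real (x * I_f (w * x\<^sup>2)) - (\<Sum>n<2 * K. odd_coeff w n * of_real x ^ n))
        \<le> w ^ K * p * norm (complex_of_real x ^ (2 * K))"
      using ev
    proof eventually_elim
      case (elim x)
      define J where "J = I_f (w * x\<^sup>2) + (\<Sum>k<K. (- (w * x\<^sup>2)) ^ k * (pi * mean_abs_sum k / 2))"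
      have J: "\<bar>J\<bar> \<le> (w * x\<^sup>2) ^ K * p"
        unfolding J_def p_def using w by (intro I_f_expansion) (auto simp: K_def)
      have "complex_of_real (x * I_f (w * x\<^sup>2)) - (\<Sum>n<2 * K. odd_coeff w n * of_real x ^ n) = of_real (x * J)"
        unfolding sum_odd_coeff of_real_diff [symmetric]
        by (simp add: J_def sum_negf distrib_left right_diff_distrib)
      moreover have "\<bar>x * J\<bar> \<le> (w * x\<^sup>2) ^ K * p"
        using mult_mono[OF elim J] by (simp add: abs_mult)
      moreover have "(w * x\<^sup>2) ^ K * p = w ^ K * p * \<bar>x\<bar> ^ (2 * K)"
        by (simp add: power_mult_distrib power_mult)
      ultimately show ?case by (simp add: norm_power del: of_real_mult)
    qed
  qed
  thus "\<exists>M\<ge>N. (\<lambda>x. complex_of_real (x * I_f (w * x\<^sup>2)) - (\<Sum>n<M. odd_coeff w n * of_real x ^ n))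
      \<in> O[F](\<lambda>x. of_real x ^ M)"
    by (intro exI[of _ "2 * K"]) (auto simp: K_def)
qed

text \<open>At an odd index the two coefficients are \<open>b n\<close> and \<open>- b n\<close>.
  Either they differ and the common part is 0 by definition, or they agree and are then both 0; so
  it need not be known which \<open>b n\<close> vanish.\<close>

lemma common_part_even_odd:
  assumes "\<And>n. odd n \<Longrightarrow> fps_nth G n = 0" "\<And>n. even n \<Longrightarrow> b n = 0"
  shows "common_part (fps_to_fls (Abs_fps (\<lambda>n. fps_nth G n + b n)))
           (fps_to_fls (Abs_fps (\<lambda>n. fps_nth G n + - b n))) = G"
proof (rule fps_ext)
  fix n
  show "fps_nth (common_part (fps_to_fls (Abs_fps (\<lambda>n. fps_nth G n + b n)))
           (fps_to_fls (Abs_fps (\<lambda>n. fps_nth G n + - b n)))) n = fps_nth G n"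
    using assms[of n] by (cases "even n") (auto simp: common_part_def)
qed

lemma even_has_fps_expansion:
  fixes h :: "complex \<Rightarrow> complex"
  assumes "h analytic_on {0}"
  obtains G where "(\<lambda>z. h (z\<^sup>2)) has_fps_expansion G" "\<And>n. odd n \<Longrightarrow> fps_nth G n = 0"
proof
  let ?G = "fps_expansion h 0 oo (fps_X ^ 2)"
  have "(h \<circ> (\<lambda>z. z ^ 2)) has_fps_expansion ?G"
    by (intro has_fps_expansion_compose analytic_at_imp_has_fps_expansion_0 assms fps_expansion_intros) auto
  thus "(\<lambda>z. h (z\<^sup>2)) has_fps_expansion ?G" by (simp add: o_def)
  show "fps_nth ?G n = 0" if "odd n" for n
    using that by (simp add: fps_nth_compose_X_power)
qed

text \<open>The domain of the distillate is the plane without the poles of the two closed forms.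
  These are the roots of a polynomial that is nonzero for every \<open>w\<close> because of its
  constant term 1, and deleting finitely many points keeps the plane connected.\<close>

lemma connected_compl_quadratic_zeros:
  fixes w :: complex
  shows "open {z. 1 + w * z\<^sup>2 \<noteq> 0}" "connected {z. 1 + w * z\<^sup>2 \<noteq> 0}"
proof -
  have "continuous_on UNIV (\<lambda>z. 1 + w * z\<^sup>2)" by (intro continuous_intros)
  thus "open {z. 1 + w * z\<^sup>2 \<noteq> 0}"
    by (intro open_Collect_neq) (auto intro!: continuous_intros)
  have "finite {z. poly [:1, 0, w:] z = 0}"
    by (rule poly_roots_finite) simp
  moreover have "{z. 1 + w * z\<^sup>2 \<noteq> 0} = UNIV - {z. poly [:1, 0, w:] z = 0}"
    by (auto simp: power2_eq_square mult_ac)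
  ultimately show "connected {z. 1 + w * z\<^sup>2 \<noteq> 0}"
    by (auto intro!: connected_open_delete_finite)
qed

lemma analytic_distillate_Psi:
  fixes T0 r :: real
  defines "R \<equiv> complex_of_real r" and "T \<equiv> complex_of_real T0"
  shows "analytic_distillate (\<lambda>\<phi>. complex_of_real (Psi T0 r \<phi>)) {z. 1 + R\<^sup>2 * T\<^sup>2 * z\<^sup>2 \<noteq> 0}
     (\<lambda>z. 1 / 12 * (T\<^sup>2 / (1 + R\<^sup>2 * T\<^sup>2 * z\<^sup>2))
        - R\<^sup>2 * T ^ 4 * z ^ 4 / (48 * complex_of_real (pi\<^sup>2) * (1 + R\<^sup>2 * T\<^sup>2 * z\<^sup>2)\<^sup>2))"
    (is "analytic_distillate _ ?D ?g")
  unfolding analytic_distillate_def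
proof (intro conjI)
  show "open ?D" "connected ?D" by (rule connected_compl_quadratic_zeros)+
  show "0 \<in> ?D" by simp
  show "?g holomorphic_on ?D" by (intro holomorphic_intros) auto
  define w where "w = r\<^sup>2 * T0\<^sup>2"
  define c where "c = complex_of_real (T0\<^sup>2 / (2 * pi\<^sup>2))"
  \<comment> \<open>The closed form written in the variable \<open>z\<^sup>2\<close>, so that its
    Taylor series at 0 is visibly even.\<close>
  define h where "h z = 1 / 12 * (T\<^sup>2 / (1 + R\<^sup>2 * T\<^sup>2 * z))
        - R\<^sup>2 * T ^ 4 * z\<^sup>2 / (48 * complex_of_real (pi\<^sup>2) * (1 + R\<^sup>2 * T\<^sup>2 * z)\<^sup>2)" for z
  have "h analytic_on {0}" unfolding h_def by (intro analytic_intros) auto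
  then obtain G where "(\<lambda>z. h (z\<^sup>2)) has_fps_expansion G" and odd: "\<And>n. odd n \<Longrightarrow> fps_nth G n = 0"
    by (rule even_has_fps_expansion) blast
  moreover have "h (z\<^sup>2) = ?g z" for z
    by (simp add: h_def power_mult [symmetric])
  ultimately have G: "?g has_fps_expansion G" by simp
  define b where "b n = c * odd_coeff w n" for n
  \<comment> \<open>\<epsilon> is the sign that relates \<open>\<bar>x\<bar>\<close> to
    \<open>x\<close> along \<open>F\<close>; the values 1 and -1 give the right and left
    expansions.\<close>
  have expansion: "power_expansion (\<lambda>x. complex_of_real (Psi T0 r x)) (\<lambda>n. fps_nth G n + \<epsilon> * b n) F"
    if F: "F \<le> at 0" and sgn: "eventually (\<lambda>x. complex_of_real \<bar>x\<bar> = \<epsilon> * of_real x) F" for F \<epsilon>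
  proof (rule power_expansion_perturb)
    show "power_expansion (\<lambda>x. ?g (of_real x) + \<epsilon> * (c * complex_of_real (x * I_f (w * x\<^sup>2))))
        (\<lambda>n. fps_nth G n + \<epsilon> * b n) F"
      unfolding b_def
      by (intro power_expansion_add power_expansion_cmult odd_part_expansion F
            has_fps_expansion_imp_power_expansion[OF G]) (simp add: w_def)
    fix N
    define rem where "rem \<phi> = Psi T0 r \<phi> -
       (1 / 12 * (T0\<^sup>2 / (1 + r\<^sup>2 * T0\<^sup>2 * \<phi>\<^sup>2))
        - r\<^sup>2 * T0 ^ 4 * \<phi> ^ 4 / (48 * pi\<^sup>2 * (1 + r\<^sup>2 * T0\<^sup>2 * \<phi>\<^sup>2)\<^sup>2)
        + I_f (r\<^sup>2 * T0\<^sup>2 * \<phi>\<^sup>2) * (\<bar>\<phi>\<bar> * T0\<^sup>2 / (2 * pi\<^sup>2)))" for \<phi>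
    have "(\<lambda>x. complex_of_real (rem x)) \<in> O[F](\<lambda>x. complex_of_real x ^ N)"
    proof -
      obtain C where "eventually (\<lambda>x. norm (rem x) \<le> C * norm (\<bar>x\<bar> ^ N)) F"
        using Psi_remainder_bigo[OF F, of T0 r N, folded rem_def] by (elim landau_o.bigE)
      thus ?thesis
        by (intro bigoI[of _ C]) (simp add: norm_power)
    qed
    moreover have "eventually (\<lambda>x. complex_of_real (rem x) = complex_of_real (Psi T0 r x) -
        (?g (of_real x) + \<epsilon> * (c * complex_of_real (x * I_f (w * x\<^sup>2))))) F"
      using sgn
    proof eventually_elim
      case (elim x)
      have "complex_of_real (I_f (r\<^sup>2 * T0\<^sup>2 * x\<^sup>2) * (\<bar>x\<bar> * T0\<^sup>2 / (2 * pi\<^sup>2))) =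
          \<epsilon> * (c * complex_of_real (x * I_f (w * x\<^sup>2)))"
        unfolding of_real_mult of_real_divide elim by (simp add: c_def w_def)
      thus ?case by (simp add: rem_def R_def T_def)
    qed
    ultimately show "(\<lambda>x. complex_of_real (Psi T0 r x) -
        (?g (of_real x) + \<epsilon> * (c * complex_of_real (x * I_f (w * x\<^sup>2))))) \<in> O[F](\<lambda>x. of_real x ^ N)"
      by (simp only: landau_o.big.in_cong)
  qed
  have "power_expansion (\<lambda>x. complex_of_real (Psi T0 r x)) (\<lambda>n. fps_nth G n + 1 * b n) (at_right 0)"
    by (rule expansion) (auto simp: at_le eventually_at_filter)
  moreover have "power_expansion (\<lambda>x. complex_of_real (Psi T0 r x)) (\<lambda>n. fps_nth G n + (-1) * b n) (at_left 0)"
    by (rule expansion) (auto simp: at_le eventually_at_filter)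
  moreover have "common_part (fps_to_fls (Abs_fps (\<lambda>n. fps_nth G n + b n)))
           (fps_to_fls (Abs_fps (\<lambda>n. fps_nth G n + - b n))) = G"
    by (rule common_part_even_odd) (auto simp: odd b_def odd_coeff_def)
  ultimately show "\<exists>A B. asymptotic_series (\<lambda>\<phi>. complex_of_real (Psi T0 r \<phi>)) A (at_right 0) \<and>
      asymptotic_series (\<lambda>\<phi>. complex_of_real (Psi T0 r \<phi>)) B (at_left 0) \<and>
      ?g has_fps_expansion common_part A B"
    using G
    by (intro exI[of _ "fps_to_fls (Abs_fps (\<lambda>n. fps_nth G n + b n))"]
              exI[of _ "fps_to_fls (Abs_fps (\<lambda>n. fps_nth G n + - b n))"] conjI
              power_expansion_imp_asymptotic_series) (simp_all add: at_le)
qed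

theorem mainTheorem10:
  fixes T0 r :: real
  assumes "T0 > 0" and "r \<ge> 0"
  shows
    "(\<forall>N::nat.
        (\<lambda>\<phi>. Psi T0 r \<phi> -
           (1 / 12 * (T0\<^sup>2 / (1 + r\<^sup>2 * T0\<^sup>2 * \<phi>\<^sup>2))
            - r\<^sup>2 * T0 ^ 4 * \<phi> ^ 4 / (48 * pi\<^sup>2 * (1 + r\<^sup>2 * T0\<^sup>2 * \<phi>\<^sup>2)\<^sup>2)
            + I_f (r\<^sup>2 * T0\<^sup>2 * \<phi>\<^sup>2) * (\<phi> * T0\<^sup>2 / (2 * pi\<^sup>2))))
          \<in> O[at_right 0](\<lambda>\<phi>. \<bar>\<phi>\<bar> ^ N)) \<and>
     (\<forall>N::nat.
        (\<lambda>\<phi>. Psi T0 r \<phi> -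
           (1 / 12 * (T0\<^sup>2 / (1 + r\<^sup>2 * T0\<^sup>2 * \<phi>\<^sup>2))
            - r\<^sup>2 * T0 ^ 4 * \<phi> ^ 4 / (48 * pi\<^sup>2 * (1 + r\<^sup>2 * T0\<^sup>2 * \<phi>\<^sup>2)\<^sup>2)
            - I_f (r\<^sup>2 * T0\<^sup>2 * \<phi>\<^sup>2) * (\<phi> * T0\<^sup>2 / (2 * pi\<^sup>2))))
          \<in> O[at_left 0](\<lambda>\<phi>. \<bar>\<phi>\<bar> ^ N)) \<and>
     (let R = complex_of_real r; T = complex_of_real T0;
          D = {z :: complex. 1 + R\<^sup>2 * T\<^sup>2 * z\<^sup>2 \<noteq> 0};
          g = (\<lambda>z :: complex.
                 1 / 12 * (T\<^sup>2 / (1 + R\<^sup>2 * T\<^sup>2 * z\<^sup>2))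
                 - R\<^sup>2 * T ^ 4 * z ^ 4
                     / (48 * complex_of_real (pi\<^sup>2) * (1 + R\<^sup>2 * T\<^sup>2 * z\<^sup>2)\<^sup>2))
      in analytic_distillate (\<lambda>\<phi>. complex_of_real (Psi T0 r \<phi>)) D g \<and>
         (\<forall>\<omega>::real. r * \<bar>\<omega>\<bar> < 1 \<longrightarrow>
            \<i> * complex_of_real (\<omega> / T0) \<in> D \<and>
            g (\<i> * complex_of_real (\<omega> / T0)) =
              complex_of_real
                (1 / 12 * (T0\<^sup>2 / (1 - r\<^sup>2 * \<omega>\<^sup>2))
                 - r\<^sup>2 * \<omega> ^ 4 / (48 * pi\<^sup>2 * (1 - r\<^sup>2 * \<omega>\<^sup>2)\<^sup>2)) \<and>
            1 / 12 * (T0\<^sup>2 / (1 - r\<^sup>2 * \<omega>\<^sup>2))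
              - r\<^sup>2 * \<omega> ^ 4 / (48 * pi\<^sup>2 * (1 - r\<^sup>2 * \<omega>\<^sup>2)\<^sup>2) =
              1 / (12 * beta_sq T0 r \<omega>)
              + alpha_sq T0 r \<omega> / (48 * pi\<^sup>2 * beta_sq T0 r \<omega>)))"
proof (intro conjI, goal_cases)
  case 1
  show ?case
  proof
    fix N
    show "(\<lambda>\<phi>. Psi T0 r \<phi> -
           (1 / 12 * (T0\<^sup>2 / (1 + r\<^sup>2 * T0\<^sup>2 * \<phi>\<^sup>2))
            - r\<^sup>2 * T0 ^ 4 * \<phi> ^ 4 / (48 * pi\<^sup>2 * (1 + r\<^sup>2 * T0\<^sup>2 * \<phi>\<^sup>2)\<^sup>2)
            + I_f (r\<^sup>2 * T0\<^sup>2 * \<phi>\<^sup>2) * (\<phi> * T0\<^sup>2 / (2 * pi\<^sup>2))))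
          \<in> O[at_right 0](\<lambda>\<phi>. \<bar>\<phi>\<bar> ^ N)"
    proof (rule landau_o.big.in_cong[THEN iffD1])
      show "(\<lambda>\<phi>. Psi T0 r \<phi> -
           (1 / 12 * (T0\<^sup>2 / (1 + r\<^sup>2 * T0\<^sup>2 * \<phi>\<^sup>2))
            - r\<^sup>2 * T0 ^ 4 * \<phi> ^ 4 / (48 * pi\<^sup>2 * (1 + r\<^sup>2 * T0\<^sup>2 * \<phi>\<^sup>2)\<^sup>2)
            + I_f (r\<^sup>2 * T0\<^sup>2 * \<phi>\<^sup>2) * (\<bar>\<phi>\<bar> * T0\<^sup>2 / (2 * pi\<^sup>2))))
          \<in> O[at_right 0](\<lambda>\<phi>. \<bar>\<phi>\<bar> ^ N)"
        by (rule Psi_remainder_bigo) (simp add: at_le)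
    qed (simp add: eventually_at_filter)
  qed
next
  case 2
  show ?case
  proof
    fix N
    show "(\<lambda>\<phi>. Psi T0 r \<phi> -
           (1 / 12 * (T0\<^sup>2 / (1 + r\<^sup>2 * T0\<^sup>2 * \<phi>\<^sup>2))
            - r\<^sup>2 * T0 ^ 4 * \<phi> ^ 4 / (48 * pi\<^sup>2 * (1 + r\<^sup>2 * T0\<^sup>2 * \<phi>\<^sup>2)\<^sup>2)
            - I_f (r\<^sup>2 * T0\<^sup>2 * \<phi>\<^sup>2) * (\<phi> * T0\<^sup>2 / (2 * pi\<^sup>2))))
          \<in> O[at_left 0](\<lambda>\<phi>. \<bar>\<phi>\<bar> ^ N)"
    \<comment> \<open>To the left of 0, \<open>\<bar>\<phi>\<bar>\<close> is
      \<open>- \<phi>\<close>, which produces the lower sign.\<close>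
    proof (rule landau_o.big.in_cong[THEN iffD1])
      show "(\<lambda>\<phi>. Psi T0 r \<phi> -
           (1 / 12 * (T0\<^sup>2 / (1 + r\<^sup>2 * T0\<^sup>2 * \<phi>\<^sup>2))
            - r\<^sup>2 * T0 ^ 4 * \<phi> ^ 4 / (48 * pi\<^sup>2 * (1 + r\<^sup>2 * T0\<^sup>2 * \<phi>\<^sup>2)\<^sup>2)
            + I_f (r\<^sup>2 * T0\<^sup>2 * \<phi>\<^sup>2) * (\<bar>\<phi>\<bar> * T0\<^sup>2 / (2 * pi\<^sup>2))))
          \<in> O[at_left 0](\<lambda>\<phi>. \<bar>\<phi>\<bar> ^ N)"
        by (rule Psi_remainder_bigo) (simp add: at_le)
    qed (simp add: eventually_at_filter)
  qed
next
  case 3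
  show ?case
    unfolding Let_def
  proof (intro conjI allI impI)
    fix \<omega> :: real
    assume "r * \<bar>\<omega>\<bar> < 1"
    hence "(r * \<bar>\<omega>\<bar>)\<^sup>2 < 1"
      using assms by (simp add: power_less_one_iff abs_square_less_1)
    hence pos: "1 - r\<^sup>2 * \<omega>\<^sup>2 > 0" by (simp add: power_mult_distrib)
    have z: "1 + (complex_of_real r)\<^sup>2 * (complex_of_real T0)\<^sup>2 * (\<i> * complex_of_real (\<omega> / T0))\<^sup>2 =
        complex_of_real (1 - r\<^sup>2 * \<omega>\<^sup>2)"
      using assms by (simp add: power_mult_distrib power_divide)
    show "\<i> * complex_of_real (\<omega> / T0) \<in> {z. 1 + (complex_of_real r)\<^sup>2 * (complex_of_real T0)\<^sup>2 * z\<^sup>2 \<noteq> 0}"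
      unfolding mem_Collect_eq z of_real_eq_0_iff using pos by simp
    \<comment> \<open>The square of the imaginary point turns \<open>1 + ...\<close> into
      \<open>1 - ...\<close>, whereas its fourth power is positive, so the second term keeps its
      sign.\<close>
    have num: "(complex_of_real r)\<^sup>2 * (complex_of_real T0) ^ 4 * (\<i> * complex_of_real (\<omega> / T0)) ^ 4 =
        complex_of_real (r\<^sup>2 * \<omega> ^ 4)"
      using assms by (simp add: power_mult_distrib power_divide)
    show "1 / 12 * ((complex_of_real T0)\<^sup>2 /
            (1 + (complex_of_real r)\<^sup>2 * (complex_of_real T0)\<^sup>2 * (\<i> * complex_of_real (\<omega> / T0))\<^sup>2)) -
          (complex_of_real r)\<^sup>2 * (complex_of_real T0) ^ 4 * (\<i> * complex_of_real (\<omega> / T0)) ^ 4 /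
            (48 * complex_of_real (pi\<^sup>2) *
             (1 + (complex_of_real r)\<^sup>2 * (complex_of_real T0)\<^sup>2 * (\<i> * complex_of_real (\<omega> / T0))\<^sup>2)\<^sup>2) =
          complex_of_real
            (1 / 12 * (T0\<^sup>2 / (1 - r\<^sup>2 * \<omega>\<^sup>2)) - r\<^sup>2 * \<omega> ^ 4 / (48 * pi\<^sup>2 * (1 - r\<^sup>2 * \<omega>\<^sup>2)\<^sup>2))"
      unfolding z num by simp
    have "(gamma_factor r \<omega>)\<^sup>2 = 1 / (1 - r\<^sup>2 * \<omega>\<^sup>2)"
      using pos by (simp add: gamma_factor_def power2_eq_square powr_add [symmetric] powr_minus_divide)
    \<comment> \<open>Hence \<open>alpha_sq / beta_sq\<close> equals \<open>- r\<^sup>2 * \<omega> ^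
      4 / (1 - r\<^sup>2 * \<omega>\<^sup>2)\<^sup>2\<close>: one factor of the double pole comes
      from \<open>gamma_factor\<close>, the other from \<open>beta_sq\<close>.\<close>
    hence "(gamma_factor r \<omega>)\<^sup>2 - 1 = r\<^sup>2 * \<omega>\<^sup>2 / (1 - r\<^sup>2 * \<omega>\<^sup>2)"
      using pos by (simp add: field_simps)
    thus "1 / 12 * (T0\<^sup>2 / (1 - r\<^sup>2 * \<omega>\<^sup>2)) - r\<^sup>2 * \<omega> ^ 4 / (48 * pi\<^sup>2 * (1 - r\<^sup>2 * \<omega>\<^sup>2)\<^sup>2) =
        1 / (12 * beta_sq T0 r \<omega>) + alpha_sq T0 r \<omega> / (48 * pi\<^sup>2 * beta_sq T0 r \<omega>)"
      using pos assms unfolding alpha_sq_def beta_sq_def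
      by (simp add: power2_eq_square power4_eq_xxxx mult_ac)
  qed (rule analytic_distillate_Psi)
qed

end
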